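(* Consider the problem of minimizing $J(x(\cdot))=\int_{t_0}^{t_1}L(t,x(t),\dot x(t))\,dt$ over $x(\cdot)\in KC^1(I,\mathbb R^n)$ with $x(t_0)=x_0$, $x(t_1)=x_1$. Let the admissible function $\bar x(\cdot)$ be a strong local minimum in this problem, and let $\{\tau\}\subset(t_0,t_1)$ be the set of its angular points. Then: (i) Suppose $L$ is continuously differentiable in the totality of variables and triply continuously differentiable with respect to the variable $\dot x$, and let $\eta\in\mathbb R^n$, $\eta\neq0$. If $\theta\in(t_0,t_1)\setminus\{\tau\}$ and $\eta^T\bar L_{\dot x\dot x}(\theta)\eta=0$, then $\big(\eta^T\bar L_{\dot x\dot x}(\theta)\eta\big)_{\dot x}^T\eta=0$. If $\theta\in\{t_0\}\cup\{\tau\}$ and $\eta^T\bar L_{\dot x\dot x}(\theta+)\eta=0$, then $\big(\eta^T\bar L_{\dot x\dot x}(\theta+)\eta\big)_{\dot x}^T\eta=0$. If $\theta\in\{\tau\}\cup\{t_1\}$ and $\eta^T\bar L_{\dot x\dot x}(\theta-)\eta=0$, then $\big(\eta^T\bar L_{\dot x\dot x}(\theta-)\eta\big)_{\dot x}^T\eta=0$. (ii) Suppose $L$ and $L_{\dot x}$ are twice differentiable in the totality of variables, $\theta\in[t_0,t_1)$ (respectively $\theta\in(t_0,t_1]$), $\bar x(\cdot)$ is twice differentiable in a semi-neighborhood $[\theta,\theta+\alpha)\subset I$ (respectively $(\theta-\alpha,\theta]\subset I$), $\alpha>0$, of $\theta$, and for a vector $\eta\ne0$ $$E(\bar L)(\theta+,\eta)=\eta^T\bar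 L_{\dot x\dot x}(\theta+)\eta=0\qquad\big(\text{respectively } E(\bar L)(\theta-,\eta)=\eta^T\bar L_{\dot x\dot x}(\theta-)\eta=0\big).$$ Then $$\eta^T\big(\bar L_x(\theta+,\eta)-\bar L_x(\theta+)-\bar L_{x\dot x}(\theta+)\eta\big)+\frac{d}{dt}E(\bar L)(\theta+,\eta)+\frac12\frac{d}{dt}\eta^T\bar L_{\dot x\dot x}(\theta+)\eta\ge0$$ $$\Big(\text{respectively } \eta^T\big(\bar L_x(\theta-,\eta)-\bar L_x(\theta-)-\bar L_{x\dot x}(\theta-)\eta\big)+\frac{d}{dt}E(\bar L)(\theta-,\eta)+\frac12\frac{d}{dt}\eta^T\bar L_{\dot x\dot x}(\theta-)\eta\le0\Big).$$ (iii) Suppose $L$ and $L_{\dot x}$ are twice continuously differentiable in the totality of variables, $\theta\in(t_0,t_1)$, $\bar x(\cdot)$ is twice differentiable at $\theta$, and for a vector $\eta\ne0$ $$E(\bar L)(\theta,\eta)=\eta^T\bar L_{\dot x\dot x}(\theta)\eta=0.$$ Then $$\eta^T\big[L_x(\theta,\bar x(\theta),\dot{\bar x}(\theta)+\eta)-\bar L_x(\theta)-\bar L_{x\dot x}(\theta)\eta\big]=0.$$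
   Context: Setting. $(a,b)\subset\mathbb R$ is an interval, $I:=[t_0,t_1]\subset(a,b)$ with $t_0<t_1$, $x_0,x_1\in\mathbb R^n$, and $L=L(t,x,\dot x):(a,b)\times\mathbb R^n\times\mathbb R^n\to\mathbb R$ is continuously differentiable in the totality of variables; $L_x,L_{\dot x}$ are its partial gradients (column vectors) with respect to the second and third arguments, $L_{x\dot x},L_{\dot x\dot x}$ the matrices of second partial derivatives; $T$ denotes transposition. $KC^1(I,\mathbb R^n)$ is the set of piecewise-smooth functions: continuous functions $x:I\to\mathbb R^n$ whose derivative is continuous on $I$ except at finitely many points of $(t_0,t_1)$ (angular points), where $\dot x$ has discontinuities of the first kind (finite one-sided limits); at $t_0$ and $t_1$ the right, respectively left, values of $\dot x$ are finite. A function $x(\cdot)\in KC^1(I,\mathbb R^n)$ with $x(t_0)=x_0$, $x(t_1)=x_1$ is called admissible. An admissible $\bar x(\cdot)$ is a strong local minimum if there is $\bar\delta>0$ such that $J(x(\cdot))\ge J(\bar x(\cdot))$ for all admissible $x(\cdot)$ with $\|x(\cdot)-\bar x(\cdot)\|_{C(I,\mathbb R^n)}\le\bar\delta$. Notation along $\bar x(\cdot)$, for $\xi\in\mathbb R^n$: a bar means evaluation along $\bar x(\cdot)$: $\bar L(t)=L(t,\bar x(t),\dot{\bar x}(t))$, and similarly $\bar L_x(t),\bar L_{\dot x}(t),\bar L_{x\dot x}(t),\bar L_{\dot x\dot x}(t)$; $\bar L_x(t,\xi)=L_x(t,\bar x(t),\dot{\bar x}(t)+\xi)$; $$E(\bar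 L)(t,\xi)=L(t,\bar x(t),\dot{\bar x}(t)+\xi)-\bar L(t)-\bar L_{\dot x}^T(t)\xi .$$ $\big(\eta^T\bar L_{\dot x\dot x}(t)\eta\big)_{\dot x}$ is the gradient with respect to $\dot x$ of the function $\eta^TL_{\dot x\dot x}(t,x,\dot x)\eta$, evaluated at $x=\bar x(t)$, $\dot x=\dot{\bar x}(t)$. One-sided values: $F(\theta+)$ (resp. $F(\theta-)$) is the right-hand (left-hand) limit of $F$ at $\theta$; for the functions above it is obtained by using $\dot{\bar x}(\theta+)$ (resp. $\dot{\bar x}(\theta-)$) in place of $\dot{\bar x}(\theta)$. $\frac{d}{dt}F(\theta\pm)$ is the corresponding one-sided derivative at $\theta$ of $t\mapsto F(t)$ (other arguments fixed), where the value at $\theta$ is taken to be $F(\theta\pm)$. *)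

theory Defs
  imports "HOL-Analysis.Analysis"
begin

text \<open>The set \<open>U\<close> is meant to be open, so that \<open>at p\<close> and \<open>at p within U\<close> agree on it.
  Derivatives are bounded linear operators, so continuity and differentiability of the derivative
  are taken in the operator norm.\<close>

definition C1_on :: "'a::real_normed_vector set \<Rightarrow> ('a \<Rightarrow> 'b::real_normed_vector) \<Rightarrow> bool" where
  "C1_on U f \<longleftrightarrow>
     (\<exists>f'. (\<forall>p\<in>U. (f has_derivative blinfun_apply (f' p)) (at p)) \<and> continuous_on U f')"

definition C2_on :: "'a::real_normed_vector set \<Rightarrow> ('a \<Rightarrow> 'b::real_normed_vector) \<Rightarrow> bool" where
  "C2_on U f \<longleftrightarrow>
     (\<exists>f'. (\<forall>p\<in>U. (f has_derivative blinfun_apply (f' p)) (at p)) \<and> C1_on U f')"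

definition C3_on :: "'a::real_normed_vector set \<Rightarrow> ('a \<Rightarrow> 'b::real_normed_vector) \<Rightarrow> bool" where
  "C3_on U f \<longleftrightarrow>
     (\<exists>f'. (\<forall>p\<in>U. (f has_derivative blinfun_apply (f' p)) (at p)) \<and> C2_on U f')"

definition twice_differentiable_on ::
    "'a::real_normed_vector set \<Rightarrow> ('a \<Rightarrow> 'b::real_normed_vector) \<Rightarrow> bool" where
  "twice_differentiable_on U f \<longleftrightarrow>
     (\<exists>f'. (\<forall>p\<in>U. (f has_derivative blinfun_apply (f' p)) (at p)) \<and>
           (\<forall>p\<in>U. f' differentiable (at p)))"

text \<open>At the end points of the interval on which a curve is considered, \<open>velocity\<close> is a two-sided
  derivative and depends on values outside the interval; there only its
  one-sided limits matter (single points do not affect the integral). At other points without derivative its value is arbitrary.\<close>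

definition velocity :: "(real \<Rightarrow> 'a::real_normed_vector) \<Rightarrow> real \<Rightarrow> 'a" where
  "velocity x t = vector_derivative x (at t)"

definition velocity_right :: "(real \<Rightarrow> 'a::real_normed_vector) \<Rightarrow> real \<Rightarrow> 'a" where
  "velocity_right x t = Lim (at_right t) (velocity x)"

definition velocity_left :: "(real \<Rightarrow> 'a::real_normed_vector) \<Rightarrow> real \<Rightarrow> 'a" where
  "velocity_left x t = Lim (at_left t) (velocity x)"

text \<open>If the velocity of a continuous curve has equal finite one-sided limits at \<open>t\<close>, then the curve
  is differentiable at \<open>t\<close> and its velocity is continuous there. So for curves in \<open>KC1\<close> the angular
  points are exactly the jump points of the velocity.\<close>

definition angular_points :: "real \<Rightarrow> real \<Rightarrow> (real \<Rightarrow> 'a::real_normed_vector) \<Rightarrow> real set" where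
  "angular_points t0 t1 x =
     {t \<in> {t0<..<t1}. \<not> (x differentiable (at t) \<and> isCont (velocity x) t)}"

definition KC1 :: "real \<Rightarrow> real \<Rightarrow> (real \<Rightarrow> 'a::real_normed_vector) set" where
  "KC1 t0 t1 = {x. continuous_on {t0..t1} x \<and>
     finite (angular_points t0 t1 x) \<and>
     (\<forall>t \<in> {t0} \<union> angular_points t0 t1 x. \<exists>l. (velocity x \<longlongrightarrow> l) (at_right t)) \<and>
     (\<forall>t \<in> angular_points t0 t1 x \<union> {t1}. \<exists>l. (velocity x \<longlongrightarrow> l) (at_left t))}"

definition functional_J ::
    "(real \<Rightarrow> 'a::real_normed_vector \<Rightarrow> 'a \<Rightarrow> real) \<Rightarrow> real \<Rightarrow> real \<Rightarrow> (real \<Rightarrow> 'a) \<Rightarrow> real" where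
  "functional_J L t0 t1 x = integral {t0..t1} (\<lambda>t. L t (x t) (velocity x t))"

definition admissible ::
    "real \<Rightarrow> real \<Rightarrow> 'a::real_normed_vector \<Rightarrow> 'a \<Rightarrow> (real \<Rightarrow> 'a) \<Rightarrow> bool" where
  "admissible t0 t1 x0 x1 x \<longleftrightarrow> x \<in> KC1 t0 t1 \<and> x t0 = x0 \<and> x t1 = x1"

definition C_norm :: "real \<Rightarrow> real \<Rightarrow> (real \<Rightarrow> 'a::real_normed_vector) \<Rightarrow> real" where
  "C_norm t0 t1 h = (SUP t\<in>{t0..t1}. norm (h t))"

definition strong_local_minimum ::
    "(real \<Rightarrow> 'a::real_normed_vector \<Rightarrow> 'a \<Rightarrow> real) \<Rightarrow> real \<Rightarrow> real \<Rightarrow> 'a \<Rightarrow> 'a \<Rightarrow> (real \<Rightarrow> 'a) \<Rightarrow> bool"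
  where
  "strong_local_minimum L t0 t1 x0 x1 xb \<longleftrightarrow>
     admissible t0 t1 x0 x1 xb \<and>
     (\<exists>\<delta>>0. \<forall>x. admissible t0 t1 x0 x1 x \<and> C_norm t0 t1 (\<lambda>t. x t - xb t) \<le> \<delta>
        \<longrightarrow> functional_J L t0 t1 x \<ge> functional_J L t0 t1 xb)"

definition gradient :: "('a::real_inner \<Rightarrow> real) \<Rightarrow> 'a \<Rightarrow> 'a" where
  "gradient f p = (THE g. GDERIV f p :> g)"

text \<open>The argument \<open>v\<close> stands for the third variable (the derivative of \<open>x\<close>).
  The entry \<open>(i, j)\<close> of \<open>L_xv\<close> is the derivative with respect to \<open>v\<^sub>j\<close> of component \<open>i\<close>
  of \<open>L_x\<close>.\<close>

definition L_x :: "(real \<Rightarrow> real^'n \<Rightarrow> real^'n \<Rightarrow> real) \<Rightarrow> real \<Rightarrow> real^'n \<Rightarrow> real^'n \<Rightarrow> real^'n" where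
  "L_x L t x v = gradient (\<lambda>y. L t y v) x"

definition L_v :: "(real \<Rightarrow> real^'n \<Rightarrow> real^'n \<Rightarrow> real) \<Rightarrow> real \<Rightarrow> real^'n \<Rightarrow> real^'n \<Rightarrow> real^'n" where
  "L_v L t x v = gradient (\<lambda>w. L t x w) v"

definition L_xv ::
    "(real \<Rightarrow> real^'n \<Rightarrow> real^'n \<Rightarrow> real) \<Rightarrow> real \<Rightarrow> real^'n \<Rightarrow> real^'n \<Rightarrow> real^'n^'n" where
  "L_xv L t x v = jacobian (\<lambda>w. L_x L t x w) (at v)"

definition L_vv ::
    "(real \<Rightarrow> real^'n \<Rightarrow> real^'n \<Rightarrow> real) \<Rightarrow> real \<Rightarrow> real^'n \<Rightarrow> real^'n \<Rightarrow> real^'n^'n" where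
  "L_vv L t x v = jacobian (\<lambda>w. L_v L t x w) (at v)"

definition quad_vv ::
    "(real \<Rightarrow> real^'n \<Rightarrow> real^'n \<Rightarrow> real) \<Rightarrow> real^'n \<Rightarrow> real \<Rightarrow> real^'n \<Rightarrow> real^'n \<Rightarrow> real" where
  "quad_vv L \<eta> t x v = \<eta> \<bullet> (L_vv L t x v *v \<eta>)"

definition weierstrass_E ::
    "(real \<Rightarrow> real^'n \<Rightarrow> real^'n \<Rightarrow> real) \<Rightarrow> real^'n \<Rightarrow> real \<Rightarrow> real^'n \<Rightarrow> real^'n \<Rightarrow> real" where
  "weierstrass_E L \<xi> t x v = L t x (v + \<xi>) - L t x v - L_v L t x v \<bullet> \<xi>"

text \<open>On a semi-neighborhood \<open>S\<close>, derivatives at its end point are one-sided.\<close>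

definition curve_twice_differentiable_on :: "real set \<Rightarrow> (real \<Rightarrow> 'a::real_normed_vector) \<Rightarrow> bool"
  where
  "curve_twice_differentiable_on S x \<longleftrightarrow>
     x differentiable_on S \<and> (\<lambda>t. vector_derivative x (at t within S)) differentiable_on S"

definition curve_twice_differentiable_at :: "real \<Rightarrow> (real \<Rightarrow> 'a::real_normed_vector) \<Rightarrow> bool"
  where
  "curve_twice_differentiable_at \<theta> x \<longleftrightarrow>
     (\<forall>\<^sub>F t in nhds \<theta>. x differentiable (at t)) \<and> velocity x differentiable (at \<theta>)"

end

theory Submission
  imports Defs
begin

text \<open>The minimum is tested with tents: along a direction \<open>\<eta>\<close> the variation leaves the curve at
  \<open>\<theta>\<close> with slope \<open>1\<close> for a time \<open>s m\<close> and returns with slope \<open>- s\<close> in a time \<open>m\<close>; tents to the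
  left of \<open>\<theta>\<close> are treated at the same time through a sign \<open>\<sigma>\<close>. Letting \<open>m \<rightarrow> 0\<close> and then \<open>s \<rightarrow> 0\<close>
  gives the Weierstrass inequality \<open>E \<ge> 0\<close>; differentiating in the size of \<open>\<eta>\<close> gives the weak Euler
  equation tested with tents. For (i), \<open>r \<mapsto> E(r \<eta>)\<close> is nonnegative and vanishes to second order at
  \<open>0\<close>, so its third derivative there is zero. For (ii), take \<open>m = s\<close> and subtract the Euler
  equation: the increment of \<open>J\<close> is \<open>s\<^sup>4/2\<close> times \<open>\<sigma>\<close> times the asserted expression plus \<open>o(s\<^sup>4)\<close>,
  where the cubic term of \<open>E(- s \<eta>)\<close> is absent by the third order argument.
  For (iii), both one-sided inequalities hold, while \<open>E\<close> and the quadratic form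
  have a local minimum in \<open>t\<close> at \<open>\<theta>\<close>, so their derivatives vanish.\<close>

subsection \<open>Calculus along lines and curves\<close>

text \<open>In (ii) all terms have to meet at one order. With both tent parameters equal to
  \<open>s\<close>, the rise lasts \<open>s * s\<close> and the excess there is linear in time, so
  it integrates to order s^4. The return lasts \<open>s\<close>: there the quadratic form, linear in
  time, carries the factor s^2/2, and the mixed derivative in position and velocity is multiplied by
  a displacement of order s^2 and a velocity of size \<open>s\<close>; both integrate to order s^4
  as well. The first order terms are of order s^2 on each piece, so they must cancel exactly;
  testing the Euler equation with the very same tent achieves this without a du Bois-Reymond lemma.
  The curve is expanded at \<theta> alone, so the estimates are pointwise o-estimates at the start,
  all with one tolerance \<open>\<kappa>\<close>. On both sides of \<theta> the change of velocity
  next to it is \<eta>, hence the displacement is \<open>\<sigma> * \<tau>\<close> times \<eta>.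
  This puts \<sigma> in front of the terms with position derivatives, while the reversal of time
  puts it in front of the derivatives along the curve; so it factors out of the whole
  expression.\<close>

lemma has_real_derivative_along:
  fixes F :: "'b::real_normed_vector \<Rightarrow> real"
  assumes "(p has_vector_derivative p') (at r within T)" "(F has_derivative F') (at (p r))"
  shows "((\<lambda>r. F (p r)) has_real_derivative F' p') (at r within T)"
  using vector_derivative_diff_chain_within[OF assms(1) has_derivative_at_withinI[OF assms(2)]]
  by (simp add: has_real_derivative_iff_has_vector_derivative o_def)

text \<open>The second derivative need not be continuous, so the remainder is taken in Lagrange
  form. The condition \<open>t * s > 0\<close> puts the intermediate point on the side of
  \<open>s\<close>, so that sign information on one side of 0 can be used.\<close>

lemma Taylor_second_order:
  fixes h h' h'' :: "real \<Rightarrow> real"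
  assumes "\<And>r. (h has_real_derivative h' r) (at r)" "\<And>r. (h' has_real_derivative h'' r) (at r)"
    and "h 0 = 0" "h' 0 = 0" "s \<noteq> 0"
  shows "\<exists>t. t \<noteq> 0 \<and> \<bar>t\<bar> < \<bar>s\<bar> \<and> t * s > 0 \<and> h s = h'' t / 2 * s\<^sup>2"
proof -
  define diff where "diff = (\<lambda>k::nat. if k = 0 then h else if k = 1 then h' else h'')"
  have D: "\<forall>m t. m < 2 \<and> P t \<longrightarrow> (diff m has_real_derivative diff (Suc m) t) (at t)" for P
    using assms(1,2) by (auto simp: diff_def less_2_cases_iff)
  show ?thesis
  proof (cases "s < 0")
    case True
    obtain t where "s < t" "t < 0" "h s = (\<Sum>m<2. diff m 0 / fact m * s ^ m) + diff 2 t / fact 2 * s ^ 2"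
      using Maclaurin_minus[of s 2 diff h] True D by (auto simp: diff_def)
    then show ?thesis using assms
      by (intro exI[of _ t]) (auto simp: diff_def numeral_2_eq_2 mult_neg_neg)
  next
    case False
    then have "s > 0" using assms by simp
    then obtain t where "0 < t" "t < s" "h s = (\<Sum>m<2. diff m 0 / fact m * s ^ m) + diff 2 t / fact 2 * s ^ 2"
      using Maclaurin[of s 2 diff h] D by (auto simp: diff_def)
    then show ?thesis using assms
      by (intro exI[of _ t]) (auto simp: diff_def numeral_2_eq_2)
  qed
qed

lemma second_derivative_nonneg:
  fixes h h' h'' :: "real \<Rightarrow> real"
  assumes "\<And>r. (h has_real_derivative h' r) (at r)" "\<And>r. (h' has_real_derivative h'' r) (at r)"
    and "h 0 = 0" "h' 0 = 0" "\<And>r. h r \<ge> 0" "isCont h'' 0"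
  shows "h'' 0 \<ge> 0"
proof (rule ccontr)
  assume "\<not> h'' 0 \<ge> 0"
  then have "\<forall>\<^sub>F r in at 0. h'' r < 0"
    using order_tendstoD(2)[of h'' "h'' 0" "at 0" 0] assms(6) by (auto simp: isCont_def)
  then have "\<exists>d>0. \<forall>r. r \<noteq> 0 \<and> \<bar>r\<bar> < d \<longrightarrow> h'' r < 0"
    by (simp add: eventually_at)
  then obtain d where d: "d > 0" "\<And>r. r \<noteq> 0 \<Longrightarrow> \<bar>r\<bar> < d \<Longrightarrow> h'' r < 0"
    by blast
  obtain t where t: "t \<noteq> 0" "\<bar>t\<bar> < \<bar>d\<bar>" "h d = h'' t / 2 * d\<^sup>2"
    using Taylor_second_order[OF assms(1-4), of d] d(1) by auto
  have "h'' t / 2 < 0" using d t by simp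
  then have "h d < 0" using d(1) unfolding t(3) by (intro mult_neg_pos) auto
  then show False using assms(5)[of d] by simp
qed

text \<open>Such an \<open>h\<close> behaves like D r^3 / 6 and would take both signs. As the third
  derivative is given at 0 alone, only the sign of \<open>D\<close> is exploited: it fixes a side of
  0 on which \<open>h''\<close> is negative, and the Lagrange remainder makes \<open>h\<close>
  negative there.\<close>

lemma third_derivative_zero:
  fixes h h' h'' :: "real \<Rightarrow> real"
  assumes "\<And>r. (h has_real_derivative h' r) (at r)" "\<And>r. (h' has_real_derivative h'' r) (at r)"
    and "(h'' has_real_derivative D) (at 0)"
    and "h 0 = 0" "h' 0 = 0" "h'' 0 = 0" "\<And>r. h r \<ge> 0"
  shows "D = 0"
proof (rule ccontr)
  assume "D \<noteq> 0"
  obtain s where s: "s \<noteq> 0" "\<And>t. \<bar>t\<bar> < \<bar>s\<bar> \<Longrightarrow> t * s > 0 \<Longrightarrow> h'' t < 0"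
  proof (cases "D > 0")
    case True
    then obtain d where d: "d > 0" "\<And>r. 0 < r \<Longrightarrow> r < d \<Longrightarrow> h'' (0 - r) < h'' 0"
      using DERIV_pos_inc_left[OF assms(3)] by auto
    show thesis
    proof (rule that[of "- d"])
      fix t assume "\<bar>t\<bar> < \<bar>-d\<bar>" "t * (-d) > 0"
      then have "0 < - t" "- t < d" using d(1) by (auto simp: zero_less_mult_iff mult_less_0_iff)
      then show "h'' t < 0" using d(2)[of "- t"] assms(6) by simp
    qed (use d in auto)
  next
    case False
    then obtain d where d: "d > 0" "\<And>r. 0 < r \<Longrightarrow> r < d \<Longrightarrow> h'' (0 + r) < h'' 0"
      using DERIV_neg_dec_right[OF assms(3)] \<open>D \<noteq> 0\<close> by auto
    show thesis
      by (rule that[of d]) (use d assms(6) in \<open>auto simp: zero_less_mult_iff\<close>)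
  qed
  obtain t where t: "\<bar>t\<bar> < \<bar>s\<bar>" "t * s > 0" "h s = h'' t / 2 * s\<^sup>2"
    using Taylor_second_order[OF assms(1,2,4,5) s(1)] by auto
  have "h s < 0" using s(2)[OF t(1,2)] s(1) unfolding t(3) by (intro mult_neg_pos) auto
  then show False using assms(7)[of s] by simp
qed

text \<open>The integral estimate behind both tent arguments: \<open>\<beta> = 0\<close> where the
  integrand is merely close to a constant, a true slope where the order s^4 has to be matched
  exactly.\<close>

lemma integral_le_affine:
  fixes g :: "real \<Rightarrow> real"
  assumes "g integrable_on {l..u}" "l \<le> u" "\<And>\<tau>. \<tau> \<in> {l..u} \<Longrightarrow> g \<tau> \<le> \<alpha> + \<beta> * \<tau>"
  shows "integral {l..u} g \<le> \<alpha> * (u - l) + \<beta> * (u\<^sup>2 - l\<^sup>2) / 2"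
proof -
  have *: "((\<lambda>\<tau>. \<alpha> + \<beta> * \<tau>) has_integral (\<alpha> * u + \<beta> * u\<^sup>2 / 2) - (\<alpha> * l + \<beta> * l\<^sup>2 / 2)) {l..u}"
    by (rule fundamental_theorem_of_calculus)
       (auto intro!: derivative_eq_intros assms simp flip: has_real_derivative_iff_has_vector_derivative)
  have "integral {l..u} g \<le> (\<alpha> * u + \<beta> * u\<^sup>2 / 2) - (\<alpha> * l + \<beta> * l\<^sup>2 / 2)"
    by (rule has_integral_le[OF integrable_integral[OF assms(1)] *]) (use assms in auto)
  then show ?thesis by (simp add: algebra_simps diff_divide_distrib)
qed

lemma has_derivative_bound:
  assumes "(g has_derivative g') (at p)" "\<kappa> > 0"
  obtains d where "d > 0" "\<And>q. norm (q - p) < d \<Longrightarrow> norm (g q - g p - g' (q - p)) \<le> \<kappa> * norm (q - p)"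
  using assms unfolding has_derivative_at_alt by blast

lemma has_vector_derivative_right_bound:
  fixes p :: "real \<Rightarrow> 'b::real_normed_vector"
  assumes "(p has_vector_derivative p') (at_right 0)" "\<kappa> > 0"
  obtains d where "d > 0" "\<And>\<tau>. 0 \<le> \<tau> \<Longrightarrow> \<tau> < d \<Longrightarrow> norm (p \<tau> - p 0 - \<tau> *\<^sub>R p') \<le> \<kappa> * \<tau>"
proof -
  obtain d where d: "d > 0" "\<And>\<tau>. \<tau> > 0 \<Longrightarrow> norm (\<tau> - 0) < d \<Longrightarrow>
      norm (p \<tau> - p 0 - (\<tau> - 0) *\<^sub>R p') \<le> \<kappa> * norm (\<tau> - 0)"
    using assms unfolding has_vector_derivative_def has_derivative_within_alt by (metis greaterThan_iff)
  show thesis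
  proof (rule that[OF d(1)])
    fix \<tau> :: real assume "0 \<le> \<tau>" "\<tau> < d"
    then show "norm (p \<tau> - p 0 - \<tau> *\<^sub>R p') \<le> \<kappa> * \<tau>" using d(2)[of \<tau>] by (cases "\<tau> = 0") auto
  qed
qed

lemma eventually_at_right_scaled_le:
  fixes c d :: real
  assumes "d > 0"
  shows "\<forall>\<^sub>F s in at_right 0. s * c < d"
  by (rule order_tendstoD[where y=0]) (use assms in \<open>auto intro!: tendsto_eq_intros\<close>)

subsection \<open>Tent-shaped needle variations\<close>

text \<open>\<open>P \<tau>\<close> stands for time, position and velocity of the curve at \<open>\<theta> + \<sigma> \<tau>\<close>, the velocity at
  \<open>\<tau> = 0\<close> being the one-sided limit; \<open>variation\<close> says that a tent of time \<open>s m + m\<close> starting at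
  \<open>\<theta>\<close> does not decrease the functional.\<close>

locale needle =
  fixes f :: "real \<times> 'a::euclidean_space \<times> 'a \<Rightarrow> real"
    and f' :: "real \<times> 'a \<times> 'a \<Rightarrow> (real \<times> 'a \<times> 'a) \<Rightarrow>\<^sub>L real"
    and S :: "real set" and P :: "real \<Rightarrow> real \<times> 'a \<times> 'a" and \<sigma> m0 \<delta> :: real
  assumes open_S: "open S"
    and deriv: "\<And>p. p \<in> S \<times> UNIV \<Longrightarrow> (f has_derivative blinfun_apply (f' p)) (at p)"
    and cont: "continuous_on (S \<times> UNIV) f'"
    and pos: "m0 > 0" "\<delta> > 0" and sigma: "\<bar>\<sigma>\<bar> = 1"
    and contP: "continuous_on {0..m0} P"
    and P_in: "\<And>\<tau>. \<tau> \<in> {0..m0} \<Longrightarrow> P \<tau> \<in> S \<times> UNIV"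
    and variation: "\<And>\<eta> s m. s > 0 \<Longrightarrow> m > 0 \<Longrightarrow> s * m + m \<le> m0 \<Longrightarrow> s * m * norm \<eta> \<le> \<delta> \<Longrightarrow>
      0 \<le> integral {0..s*m} (\<lambda>\<tau>. f (P \<tau> + (0, (\<sigma> * \<tau>) *\<^sub>R \<eta>, \<eta>)) - f (P \<tau>)) +
          integral {s*m..s*m+m} (\<lambda>\<tau>. f (P \<tau> + (0, (\<sigma> * s * (s*m+m-\<tau>)) *\<^sub>R \<eta>, (- s) *\<^sub>R \<eta>)) - f (P \<tau>))"
begin

section \<open>Continuity along the shifted curve and the Weierstrass inequality\<close>

lemma shift_in: "p \<in> S \<times> UNIV \<Longrightarrow> p + (0, x, v) \<in> S \<times> UNIV"
  by (auto simp: mem_Times_iff)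

lemma open_dom: "open (S \<times> (UNIV :: ('a \<times> 'a) set))"
  by (intro open_Times open_S open_UNIV)

lemma isCont_f: "p \<in> S \<times> UNIV \<Longrightarrow> isCont f p"
  using deriv has_derivative_continuous by blast

lemma isCont_f': "p \<in> S \<times> UNIV \<Longrightarrow> isCont f' p"
  using cont open_dom continuous_on_eq_continuous_at by blast

lemma continuous_along:
  assumes "\<And>p. p \<in> S \<times> UNIV \<Longrightarrow> isCont g p" and "T \<subseteq> {0..m0}" "continuous_on T x" "continuous_on T v"
  shows "continuous_on T (\<lambda>\<tau>. g (P \<tau> + (0, x \<tau>, v \<tau>)))"
proof -
  have "continuous_on (S \<times> UNIV) g" using assms(1) by (simp add: continuous_at_imp_continuous_on)
  moreover have "continuous_on T P" using contP assms(2) continuous_on_subset by blast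
  then have "continuous_on T (\<lambda>\<tau>. P \<tau> + (0, x \<tau>, v \<tau>))"
    by (intro continuous_intros assms)
  ultimately show ?thesis
    by (rule continuous_on_compose2) (use assms(2) P_in shift_in in blast)
qed

lemma continuous_along0:
  assumes "\<And>p. p \<in> S \<times> UNIV \<Longrightarrow> isCont g p" and "T \<subseteq> {0..m0}"
  shows "continuous_on T (\<lambda>\<tau>. g (P \<tau>))"
  using continuous_along[of g T "\<lambda>_. 0" "\<lambda>_. 0"] assms by (simp flip: zero_prod_def)

text \<open>On each piece of a tent the velocity shift is constant while the displacement varies;
  hence \<open>w\<close> is fixed and the estimate is uniform in small \<open>x\<close>.\<close>

lemma near_start:
  assumes "isCont g (P 0 + (0, 0, w))" "\<kappa> > 0"
  obtains d where "d > 0" "d \<le> m0"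
    "\<And>\<tau> x. 0 \<le> \<tau> \<Longrightarrow> \<tau> \<le> d \<Longrightarrow> norm x \<le> d \<Longrightarrow> dist (g (P \<tau> + (0, x, w))) (g (P 0 + (0, 0, w))) < \<kappa>"
proof -
  obtain d1 where d1: "d1 > 0" "\<And>q. dist q (P 0 + (0,0,w)) < d1 \<Longrightarrow> dist (g q) (g (P 0 + (0,0,w))) < \<kappa>"
    using assms unfolding continuous_at_eps_delta by meson
  obtain d2 where d2: "d2 > 0" "\<And>\<tau>. \<tau> \<in> {0..m0} \<Longrightarrow> dist \<tau> 0 < d2 \<Longrightarrow> dist (P \<tau>) (P 0) < d1/2"
  proof -
    have "0 \<in> {0..m0}" "d1/2 > 0" using pos d1 by auto
    with contP show thesis unfolding continuous_on_iff by (meson that)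
  qed
  define d where "d = Min {m0, d1/3, d2/2}"
  have d: "d > 0" "d \<le> m0" "d < d1/2" "d < d2" using d1 d2 pos by (auto simp: d_def)
  show thesis
  proof (rule that[OF d(1,2)])
    fix \<tau> x assume a: "0 \<le> \<tau>" "\<tau> \<le> d" "norm (x::'a) \<le> d"
    have "dist (P \<tau> + (0, x, w)) (P 0 + (0, 0, w)) = norm ((P \<tau> - P 0) + (0, x, 0))"
      unfolding dist_norm by (rule arg_cong[where f=norm]) (simp add: prod_eq_iff)
    also have "\<dots> \<le> dist (P \<tau>) (P 0) + norm x"
      using norm_triangle_ineq[of "P \<tau> - P 0" "(0,x,0)"] by (simp add: dist_norm norm_prod_def)
    also have "\<dots> < d1" using d2(2)[of \<tau>] a d by (auto simp: dist_real_def)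
    finally show "dist (g (P \<tau> + (0, x, w))) (g (P 0 + (0, 0, w))) < \<kappa>" by (rule d1(2))
  qed
qed

text \<open>For fixed \<open>s\<close> both integrands approach their values at the start as
  \<open>m\<close> tends to 0. Dividing the increment by \<open>m\<close> leaves the weight
  \<open>s\<close> for the rise and the weight 1 for the return.\<close>

lemma weierstrass_slope:
  assumes s: "s > 0"
  shows "0 \<le> s * (f (P 0 + (0, 0, \<eta>)) - f (P 0)) + (f (P 0 + (0, 0, (- s) *\<^sub>R \<eta>)) - f (P 0))"
    (is "0 \<le> s * ?A + ?B")
proof (rule field_le_epsilon)
  fix \<epsilon> :: real assume "\<epsilon> > 0"
  \<comment> \<open>Each integrand is overestimated by \<open>2 * \<kappa>\<close>, and the weights
    are \<open>s\<close> and 1.\<close>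
  define \<kappa> where "\<kappa> = \<epsilon> / (2 * s + 2)"
  have k: "\<kappa> > 0" using \<open>\<epsilon> > 0\<close> s by (simp add: \<kappa>_def)
  have P0: "P 0 \<in> S \<times> UNIV" using P_in pos by simp
  obtain d1 where d1: "d1 > 0" "d1 \<le> m0" "\<And>\<tau> x. 0 \<le> \<tau> \<Longrightarrow> \<tau> \<le> d1 \<Longrightarrow> norm x \<le> d1 \<Longrightarrow>
       dist (f (P \<tau> + (0, x, \<eta>))) (f (P 0 + (0, 0, \<eta>))) < \<kappa>"
    by (rule near_start[OF isCont_f[OF shift_in[OF P0]] k, of "\<eta>"]) (rule that)
  obtain d2 where d2: "d2 > 0" "d2 \<le> m0" "\<And>\<tau> x. 0 \<le> \<tau> \<Longrightarrow> \<tau> \<le> d2 \<Longrightarrow> norm x \<le> d2 \<Longrightarrow>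
       dist (f (P \<tau> + (0, x, (- s) *\<^sub>R \<eta>))) (f (P 0 + (0, 0, (- s) *\<^sub>R \<eta>))) < \<kappa>"
    by (rule near_start[OF isCont_f[OF shift_in[OF P0]] k, of "(- s) *\<^sub>R \<eta>"]) (rule that)
  obtain d3 where d3: "d3 > 0" "d3 \<le> m0" "\<And>\<tau> x. 0 \<le> \<tau> \<Longrightarrow> \<tau> \<le> d3 \<Longrightarrow> norm x \<le> d3 \<Longrightarrow>
       dist (f (P \<tau> + (0, x, 0))) (f (P 0 + (0, 0, 0))) < \<kappa>"
    by (rule near_start[OF isCont_f[OF shift_in[OF P0]] k, of "0"]) (rule that)
  define D where "D = Min {d1, d2, d3, \<delta>}"
  have D: "D > 0" "D \<le> d1" "D \<le> d2" "D \<le> d3" "D \<le> \<delta>" "D \<le> m0" using d1 d2 d3 pos by (auto simp: D_def)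
  \<comment> \<open>This makes \<open>(s*m+m) * (norm \<eta> + 1)\<close> equal to \<open>D\<close>,
    so the duration and the height of the tent are both at most \<open>D\<close>.\<close>
  define m where "m = D / ((s + 1) * (norm \<eta> + 1))"
  have m: "m > 0" using D s by (auto simp: m_def intro!: divide_pos_pos mult_pos_pos add_nonneg_pos)
  have "(s*m+m) * (norm \<eta> + 1) = D"
    using s by (simp add: m_def field_simps add_nonneg_eq_0_iff)
  then have mD: "(s*m+m) + (s*m+m) * norm \<eta> = D" by (simp add: algebra_simps)
  have mpos: "s*m > 0" using s m by simp
  have nn: "0 \<le> s*m * norm \<eta>" "0 \<le> m * norm \<eta>" using s m by auto
  have m1: "s*m+m \<le> D" and m2: "s*m * norm \<eta> \<le> D" using mD mpos m nn by (auto simp: algebra_simps)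
  have ds: "(0::real, 0::'a, 0::'a) = 0" by (simp add: zero_prod_def)
  have b3: "f (P \<tau>) > f (P 0) - \<kappa>" if "0 \<le> \<tau>" "\<tau> \<le> D" for \<tau>
    using d3(3)[of \<tau> 0] that D by (auto simp: ds dist_real_def)
  have i1: "integral {0..s*m} (\<lambda>\<tau>. f (P \<tau> + (0, (\<sigma> * \<tau>) *\<^sub>R \<eta>, \<eta>)) - f (P \<tau>))
     \<le> (?A + 2*\<kappa>) * (s*m - 0) + 0 * ((s*m)\<^sup>2 - 0\<^sup>2) / 2"
  proof (rule integral_le_affine)
    show "(\<lambda>\<tau>. f (P \<tau> + (0, (\<sigma> * \<tau>) *\<^sub>R \<eta>, \<eta>)) - f (P \<tau>)) integrable_on {0..s*m}"
      by (intro integrable_continuous_real continuous_intros continuous_along continuous_along0)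
         (use isCont_f m1 D m mpos in auto)
    fix \<tau> assume t: "\<tau> \<in> {0..s*m}"
    have "norm ((\<sigma> * \<tau>) *\<^sub>R \<eta>) \<le> s*m * norm \<eta>"
      using t sigma by (auto simp: abs_mult intro!: mult_right_mono)
    then have "f (P \<tau> + (0, (\<sigma> * \<tau>) *\<^sub>R \<eta>, \<eta>)) < f (P 0 + (0, 0, \<eta>)) + \<kappa>"
      using d1(3)[of \<tau> "(\<sigma> * \<tau>) *\<^sub>R \<eta>"] t D m m1 m2 by (auto simp: dist_real_def)
    then show "f (P \<tau> + (0, (\<sigma> * \<tau>) *\<^sub>R \<eta>, \<eta>)) - f (P \<tau>) \<le> (?A + 2*\<kappa>) + 0 * \<tau>"
      using b3[of \<tau>] t m m1 by auto
  qed (use mpos in auto)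
  have i2: "integral {s*m..s*m+m} (\<lambda>\<tau>. f (P \<tau> + (0, (\<sigma> * s * (s*m+m-\<tau>)) *\<^sub>R \<eta>, (- s) *\<^sub>R \<eta>)) - f (P \<tau>))
     \<le> (?B + 2*\<kappa>) * (s*m+m - s*m) + 0 * ((s*m+m)\<^sup>2 - (s*m)\<^sup>2) / 2"
  proof (rule integral_le_affine)
    show "(\<lambda>\<tau>. f (P \<tau> + (0, (\<sigma> * s * (s*m+m-\<tau>)) *\<^sub>R \<eta>, (- s) *\<^sub>R \<eta>)) - f (P \<tau>)) integrable_on {s*m..s*m+m}"
      by (intro integrable_continuous_real continuous_intros continuous_along continuous_along0)
         (use isCont_f m1 D m mpos in auto)
    fix \<tau> assume t: "\<tau> \<in> {s*m..s*m+m}"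
    have "norm ((\<sigma> * s * (s*m+m-\<tau>)) *\<^sub>R \<eta>) \<le> s*m * norm \<eta>"
      using t sigma s by (auto simp: abs_mult intro!: mult_right_mono mult_left_mono)
    then have "f (P \<tau> + (0, (\<sigma> * s * (s*m+m-\<tau>)) *\<^sub>R \<eta>, (- s) *\<^sub>R \<eta>)) < f (P 0 + (0, 0, (- s) *\<^sub>R \<eta>)) + \<kappa>"
      using d2(3)[of \<tau> "(\<sigma> * s * (s*m+m-\<tau>)) *\<^sub>R \<eta>"] t D m m1 m2 mpos by (auto simp: dist_real_def)
    then show "f (P \<tau> + (0, (\<sigma> * s * (s*m+m-\<tau>)) *\<^sub>R \<eta>, (- s) *\<^sub>R \<eta>)) - f (P \<tau>) \<le> (?B + 2*\<kappa>) + 0 * \<tau>"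
      using b3[of \<tau>] t m m1 mpos by auto
  qed (use m in auto)
  have "0 \<le> m * (s * (?A + 2*\<kappa>) + (?B + 2*\<kappa>))"
    using variation[OF s m, of \<eta>] m1 m2 D i1 i2 by (auto simp: algebra_simps)
  then have "0 \<le> s * (?A + 2*\<kappa>) + (?B + 2*\<kappa>)" using m by (simp only: zero_le_mult_iff) auto
  also have "\<dots> = s * ?A + ?B + (2 * s + 2) * \<kappa>" by (simp add: algebra_simps)
  also have "(2 * s + 2) * \<kappa> = \<epsilon>" using s by (simp add: \<kappa>_def)
  finally show "0 \<le> s * ?A + ?B + \<epsilon>" .
qed

lemma deriv_v:
  assumes "p \<in> S \<times> UNIV"
  shows "((\<lambda>r. f (p + (0, 0, r *\<^sub>R \<eta>))) has_real_derivative f' (p + (0, 0, r *\<^sub>R \<eta>)) (0, 0, \<eta>)) (at r)"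
proof -
  have "((\<lambda>r. p + (0, 0, r *\<^sub>R \<eta>)) has_vector_derivative (0, 0, \<eta>)) (at r)"
    unfolding has_vector_derivative_def by (auto intro!: derivative_eq_intros)
  then show ?thesis
    by (rule has_real_derivative_along) (rule deriv[OF shift_in[OF assms]])
qed

text \<open>With \<open>r = - s\<close> the slope inequality bounds the difference quotient of
  \<open>f\<close> along \<eta>, taken at negative \<open>r\<close>, by the full increment. The
  quotient tends to the derivative as \<open>r\<close> increases to 0.\<close>

theorem weierstrass:
  "f (P 0 + (0, 0, \<eta>)) - f (P 0) - f' (P 0) (0, 0, \<eta>) \<ge> 0"
proof -
  have P0: "P 0 \<in> S \<times> UNIV" using P_in pos by simp
  let ?A = "f (P 0 + (0, 0, \<eta>)) - f (P 0)"
  have "((\<lambda>r. f (P 0 + (0, 0, r *\<^sub>R \<eta>))) has_real_derivative f' (P 0) (0, 0, \<eta>)) (at 0)"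
    using deriv_v[OF P0, of \<eta> 0] by (simp flip: zero_prod_def)
  then have "((\<lambda>r. (f (P 0 + (0, 0, r *\<^sub>R \<eta>)) - f (P 0)) / r) \<longlongrightarrow> f' (P 0) (0, 0, \<eta>)) (at_left 0)"
    by (auto simp: has_field_derivative_iff simp flip: zero_prod_def intro: filterlim_mono[OF _ order_refl] at_le)
  moreover have "\<forall>\<^sub>F r in at_left 0. (f (P 0 + (0, 0, r *\<^sub>R \<eta>)) - f (P 0)) / r \<le> ?A"
  proof (rule eventually_at_leftI[of "-1"])
    fix r :: real assume r: "r \<in> {-1<..<0}"
    then show "(f (P 0 + (0, 0, r *\<^sub>R \<eta>)) - f (P 0)) / r \<le> ?A"
      using weierstrass_slope[of "- r" \<eta>] by (auto simp: field_simps)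
  qed auto
  ultimately have "f' (P 0) (0, 0, \<eta>) \<le> ?A"
    by (intro tendsto_upperbound) auto
  then show ?thesis by simp
qed

section \<open>The Euler equation tested with tents\<close>

text \<open>Differentiation under the integral, justified by joint continuity of the derivative in
  \<open>c\<close> and \<open>\<tau>\<close>. It is meant for the rise and the return separately,
  since the slope of the tent jumps between them.\<close>

lemma first_variation:
  assumes "{l..u} \<subseteq> {0..m0}" "continuous_on {l..u} x" "continuous_on {l..u} v"
  shows "((\<lambda>c. integral {l..u} (\<lambda>\<tau>. f (P \<tau> + (0, c *\<^sub>R x \<tau>, c *\<^sub>R v \<tau>)) - f (P \<tau>)))
    has_real_derivative integral {l..u} (\<lambda>\<tau>. f' (P \<tau>) (0, x \<tau>, v \<tau>))) (at 0)"
proof -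
  have c1: "(\<lambda>\<tau>. f (P \<tau> + (0, c *\<^sub>R x \<tau>, c *\<^sub>R v \<tau>)) - f (P \<tau>)) integrable_on {l..u}" for c
    by (intro integrable_continuous_real continuous_on_diff continuous_along continuous_along0
        continuous_on_scaleR continuous_on_const) (use assms isCont_f in auto)
  have cP: "continuous_on {l..u} P" using contP assms(1) continuous_on_subset by blast
  have sn: "continuous_on (UNIV \<times> {l..u}) (snd :: real \<times> real \<Rightarrow> real)"
    by (rule continuous_on_snd[OF continuous_on_id])
  have P2: "continuous_on (UNIV \<times> {l..u}) (\<lambda>z::real\<times>real. P (snd z))"
    and x2: "continuous_on (UNIV \<times> {l..u}) (\<lambda>z::real\<times>real. x (snd z))"
    and v2: "continuous_on (UNIV \<times> {l..u}) (\<lambda>z::real\<times>real. v (snd z))"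
    using continuous_on_compose2[OF cP sn] continuous_on_compose2[OF assms(2) sn]
      continuous_on_compose2[OF assms(3) sn] by auto
  have "continuous_on (UNIV \<times> {l..u}) (\<lambda>z. P (snd z) + (0, fst z *\<^sub>R x (snd z), fst z *\<^sub>R v (snd z)))"
    by (rule continuous_on_add[OF P2 continuous_on_Pair[OF continuous_on_const continuous_on_Pair[OF
          continuous_on_scaleR[OF continuous_on_fst[OF continuous_on_id] x2]
          continuous_on_scaleR[OF continuous_on_fst[OF continuous_on_id] v2]]]])
  moreover have "(\<lambda>z. P (snd z) + (0, fst z *\<^sub>R x (snd z), fst z *\<^sub>R v (snd z))) ` (UNIV \<times> {l..u}) \<subseteq> S \<times> UNIV"
    using P_in assms(1) shift_in by (intro image_subsetI) (auto simp: mem_Times_iff)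
  ultimately have "continuous_on (UNIV \<times> {l..u}) (\<lambda>z. f' (P (snd z) + (0, fst z *\<^sub>R x (snd z), fst z *\<^sub>R v (snd z))))"
    by (rule continuous_on_compose2[OF cont])
  then have c2: "continuous_on (UNIV \<times> {l..u}) (\<lambda>(c, \<tau>). f' (P \<tau> + (0, c *\<^sub>R x \<tau>, c *\<^sub>R v \<tau>)) (0, x \<tau>, v \<tau>))"
    unfolding split_beta
    by (rule bounded_bilinear.continuous_on[OF bounded_bilinear_blinfun_apply _
        continuous_on_Pair[OF continuous_on_const continuous_on_Pair[OF x2 v2]]])
  have d: "((\<lambda>c. f (P \<tau> + (0, c *\<^sub>R x \<tau>, c *\<^sub>R v \<tau>)) - f (P \<tau>)) has_real_derivative
      f' (P \<tau> + (0, c *\<^sub>R x \<tau>, c *\<^sub>R v \<tau>)) (0, x \<tau>, v \<tau>)) (at c)" if "\<tau> \<in> {l..u}" for c \<tau>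
  proof -
    have "((\<lambda>c. P \<tau> + (0, c *\<^sub>R x \<tau>, c *\<^sub>R v \<tau>)) has_vector_derivative (0, x \<tau>, v \<tau>)) (at c)"
      unfolding has_vector_derivative_def by (auto intro!: derivative_eq_intros)
    moreover have "(f has_derivative f' (P \<tau> + (0, c *\<^sub>R x \<tau>, c *\<^sub>R v \<tau>))) (at (P \<tau> + (0, c *\<^sub>R x \<tau>, c *\<^sub>R v \<tau>)))"
      using deriv[OF shift_in[OF P_in]] that assms(1) by auto
    ultimately have "((\<lambda>c. f (P \<tau> + (0, c *\<^sub>R x \<tau>, c *\<^sub>R v \<tau>))) has_real_derivative
      f' (P \<tau> + (0, c *\<^sub>R x \<tau>, c *\<^sub>R v \<tau>)) (0, x \<tau>, v \<tau>)) (at c)"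
      by (rule has_real_derivative_along)
    then show ?thesis by (auto intro!: derivative_eq_intros)
  qed
  have "((\<lambda>c. integral (cbox l u) (\<lambda>\<tau>. f (P \<tau> + (0, c *\<^sub>R x \<tau>, c *\<^sub>R v \<tau>)) - f (P \<tau>)))
    has_real_derivative integral (cbox l u) (\<lambda>\<tau>. f' (P \<tau> + (0, 0 *\<^sub>R x \<tau>, 0 *\<^sub>R v \<tau>)) (0, x \<tau>, v \<tau>))) (at 0 within UNIV)"
    by (rule leibniz_rule_field_derivative) (use c1 c2 d in auto)
  then show ?thesis by (simp flip: zero_prod_def)
qed

text \<open>A tent may be scaled by a small \<open>c\<close> of either sign, so the increment has a
  local minimum at \<open>c = 0\<close> and its derivative there vanishes. This two-sidedness is why
  an equality results.\<close>

theorem euler: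
  assumes "s > 0" "m > 0" "s * m + m \<le> m0"
  shows "integral {0..s*m} (\<lambda>\<tau>. f' (P \<tau>) (0, (\<sigma> * \<tau>) *\<^sub>R \<eta>, \<eta>)) +
     integral {s*m..s*m+m} (\<lambda>\<tau>. f' (P \<tau>) (0, (\<sigma> * s * (s*m+m-\<tau>)) *\<^sub>R \<eta>, (- s) *\<^sub>R \<eta>)) = 0"
proof -
  have sm: "0 < s * m" "s * m \<le> m0" using assms by auto
  define F where "F c =
    integral {0..s*m} (\<lambda>\<tau>. f (P \<tau> + (0, c *\<^sub>R (\<sigma> * \<tau>) *\<^sub>R \<eta>, c *\<^sub>R \<eta>)) - f (P \<tau>)) +
    integral {s*m..s*m+m} (\<lambda>\<tau>. f (P \<tau> + (0, c *\<^sub>R (\<sigma> * s * (s*m+m-\<tau>)) *\<^sub>R \<eta>, c *\<^sub>R (- s) *\<^sub>R \<eta>)) - f (P \<tau>))" for c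
  have D: "(F has_real_derivative
     integral {0..s*m} (\<lambda>\<tau>. f' (P \<tau>) (0, (\<sigma> * \<tau>) *\<^sub>R \<eta>, \<eta>)) +
     integral {s*m..s*m+m} (\<lambda>\<tau>. f' (P \<tau>) (0, (\<sigma> * s * (s*m+m-\<tau>)) *\<^sub>R \<eta>, (- s) *\<^sub>R \<eta>))) (at 0)"
    unfolding F_def
    by (intro DERIV_add first_variation continuous_intros) (use sm assms in auto)
  have "\<forall>\<^sub>F c in at 0. s * m * norm (c *\<^sub>R \<eta>) < \<delta>"
    by (rule order_tendstoD[where y=0]) (use pos in \<open>auto intro!: tendsto_eq_intros\<close>)
  then obtain d where d: "d > 0" "\<And>c. c \<noteq> 0 \<Longrightarrow> \<bar>c\<bar> < d \<Longrightarrow> s * m * norm (c *\<^sub>R \<eta>) < \<delta>"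
    unfolding eventually_at by (auto simp: dist_real_def)
  have "F 0 \<le> F c" if "\<bar>0 - c\<bar> < d" for c
  proof (cases "c = 0")
    case False
    have "0 \<le> F c"
      using variation[OF assms, of "c *\<^sub>R \<eta>"] d(2)[OF False] that
      by (simp add: F_def mult_ac)
    moreover have "F 0 = 0" by (simp add: F_def flip: zero_prod_def)
    ultimately show ?thesis by simp
  qed simp
  then show ?thesis using DERIV_local_min[OF D d(1)] by blast
qed

section \<open>Expansion of the excess and the second order inequality\<close>

text \<open>Separates the displacement from the change of velocity: the intermediate point keeps the
  shift \<open>w\<close>. The parameter runs over the unit interval and is scaled by
  \<open>r\<close>, so the sign of \<open>r\<close> and the case \<open>r = 0\<close> need no
  distinction.\<close>

lemma mean_value_x:
  assumes "p \<in> S \<times> UNIV"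
  obtains \<rho> where "\<bar>\<rho>\<bar> \<le> \<bar>r\<bar>"
    "f (p + (0, r *\<^sub>R \<eta>, w)) - f (p + (0, 0, w)) = r * f' (p + (0, \<rho> *\<^sub>R \<eta>, w)) (0, \<eta>, 0)"
proof -
  have D: "((\<lambda>t. f (p + (0, (t * r) *\<^sub>R \<eta>, w))) has_real_derivative r * f' (p + (0, (t * r) *\<^sub>R \<eta>, w)) (0, \<eta>, 0)) (at t)" for t
  proof -
    have "((\<lambda>t. p + (0, (t * r) *\<^sub>R \<eta>, w)) has_vector_derivative r *\<^sub>R (0, \<eta>, 0)) (at t)"
      unfolding has_vector_derivative_def by (auto intro!: derivative_eq_intros)
    from has_real_derivative_along[OF this deriv[OF shift_in[OF assms]]] show ?thesis
      by (simp only: blinfun.scaleR_right real_scaleR_def)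
  qed
  obtain t where t: "0 < t" "t < 1" "f (p + (0, (1 * r) *\<^sub>R \<eta>, w)) - f (p + (0, (0 * r) *\<^sub>R \<eta>, w)) =
      (1 - 0) * (r * f' (p + (0, (t * r) *\<^sub>R \<eta>, w)) (0, \<eta>, 0))"
    using MVT2[of 0 1 "\<lambda>t. f (p + (0, (t * r) *\<^sub>R \<eta>, w))", OF _ D] by auto
  show thesis
    by (rule that[of "t * r"]) (use t in \<open>auto simp: abs_mult mult_left_le_one_le\<close>)
qed

text \<open>The hypothesis on \<open>Q\<close> concerns \<open>r = 0\<close> at every base point.
  Moving the base point along \<eta> turns it into the second derivative of the excess at arbitrary
  \<open>r\<close>.\<close>

lemma excess_derivs:
  assumes Q: "\<And>p. p \<in> S \<times> UNIV \<Longrightarrow>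
      ((\<lambda>r. f' (p + (0, 0, r *\<^sub>R \<eta>)) (0, 0, \<eta>)) has_real_derivative Q p) (at 0)"
    and p: "p \<in> S \<times> UNIV"
  shows "((\<lambda>r. f (p + (0, 0, r *\<^sub>R \<eta>)) - f p - r * f' p (0, 0, \<eta>)) has_real_derivative
      f' (p + (0, 0, r *\<^sub>R \<eta>)) (0, 0, \<eta>) - f' p (0, 0, \<eta>)) (at r)"
    and "((\<lambda>r. f' (p + (0, 0, r *\<^sub>R \<eta>)) (0, 0, \<eta>) - f' p (0, 0, \<eta>)) has_real_derivative
      Q (p + (0, 0, r *\<^sub>R \<eta>))) (at r)"
proof -
  show "((\<lambda>r. f (p + (0, 0, r *\<^sub>R \<eta>)) - f p - r * f' p (0, 0, \<eta>)) has_real_derivative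
      f' (p + (0, 0, r *\<^sub>R \<eta>)) (0, 0, \<eta>) - f' p (0, 0, \<eta>)) (at r)"
    using deriv_v[OF p, of \<eta> r] by (auto intro!: derivative_eq_intros)
  have "((\<lambda>t. f' (p + (0, 0, r *\<^sub>R \<eta>) + (0, 0, t *\<^sub>R \<eta>)) (0, 0, \<eta>)) has_real_derivative
      Q (p + (0, 0, r *\<^sub>R \<eta>))) (at 0)"
    by (rule Q[OF shift_in[OF p]])
  then have "((\<lambda>r. f' (p + (0, 0, r *\<^sub>R \<eta>)) (0, 0, \<eta>)) has_real_derivative
      Q (p + (0, 0, r *\<^sub>R \<eta>))) (at (0 + r))"
    unfolding DERIV_shift by (simp add: scaleR_add_left add.commute add.left_commute)
  then show "((\<lambda>r. f' (p + (0, 0, r *\<^sub>R \<eta>)) (0, 0, \<eta>) - f' p (0, 0, \<eta>)) has_real_derivative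
      Q (p + (0, 0, r *\<^sub>R \<eta>))) (at r)"
    by (auto intro!: derivative_eq_intros)
qed

lemma excess_nonneg: "f (P 0 + (0, 0, r *\<^sub>R \<eta>)) - f (P 0) - r * f' (P 0) (0, 0, \<eta>) \<ge> 0"
proof -
  have "f' (P 0) (0, 0, r *\<^sub>R \<eta>) = r * f' (P 0) (0, 0, \<eta>)"
    using blinfun.scaleR_right[of "f' (P 0)" r "(0, 0, \<eta>)"] by simp
  then show ?thesis using weierstrass[of "r *\<^sub>R \<eta>"] by simp
qed

text \<open>The excess in direction \<eta> is nonnegative and vanishes with its first derivative at
  \<open>r = 0\<close>, where its second derivative is \<open>Q (P 0)\<close>.\<close>

lemma legendre:
  assumes Q: "\<And>p. p \<in> S \<times> UNIV \<Longrightarrow>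
      ((\<lambda>r. f' (p + (0, 0, r *\<^sub>R \<eta>)) (0, 0, \<eta>)) has_real_derivative Q p) (at 0)"
    and "isCont Q (P 0)"
  shows "Q (P 0) \<ge> 0"
proof -
  have P0: "P 0 \<in> S \<times> UNIV" using P_in pos by simp
  have ds: "(0::real, 0::'a, 0::'a) = 0" by (simp add: zero_prod_def)
  have "isCont (\<lambda>r. Q (P 0 + (0, 0, r *\<^sub>R \<eta>))) 0"
    by (rule isCont_o2[where g=Q]) (use assms(2) ds in \<open>auto intro!: continuous_intros\<close>)
  then have "Q (P 0 + (0, 0, 0 *\<^sub>R \<eta>)) \<ge> 0"
    by (rule second_derivative_nonneg[OF excess_derivs(1)[OF Q P0] excess_derivs(2)[OF Q P0], rotated -1])
       (use excess_nonneg ds in auto)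
  then show ?thesis by (simp add: ds)
qed

text \<open>The bracket after \<sigma> comes from the displacement: the difference of position
  derivatives from the rise, the mixed derivative \<open>g'\<close> from the return.
  \<open>DE\<close> is the growth of the excess during the rise, and \<open>Q' P' / 2\<close> the
  growth of the quadratic form during the return, with its Taylor factor.\<close>

theorem second_order:
  assumes P': "(P has_vector_derivative P') (at_right 0)"
    and e: "((\<lambda>\<tau>. f (P \<tau> + (0, 0, \<eta>)) - f (P \<tau>) - f' (P \<tau>) (0, 0, \<eta>)) has_real_derivative DE) (at_right 0)"
    and e0: "f (P 0 + (0, 0, \<eta>)) - f (P 0) - f' (P 0) (0, 0, \<eta>) = 0"
    and g: "((\<lambda>p. f' p (0, \<eta>, 0)) has_derivative g') (at (P 0))"
    and Q: "\<And>p. p \<in> S \<times> UNIV \<Longrightarrow>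
      ((\<lambda>r. f' (p + (0, 0, r *\<^sub>R \<eta>)) (0, 0, \<eta>)) has_real_derivative Q p) (at 0)"
    and Q': "(Q has_derivative Q') (at (P 0))" and Q0: "Q (P 0) = 0"
  shows "0 \<le> \<sigma> * (f' (P 0 + (0, 0, \<eta>)) (0, \<eta>, 0) - f' (P 0) (0, \<eta>, 0) - g' (0, 0, \<eta>)) + DE + Q' P' / 2"
proof -
  have P0: "P 0 \<in> S \<times> UNIV" using P_in pos by simp
  interpret Q': bounded_linear Q' using Q' by (rule has_derivative_bounded_linear)
  interpret g': bounded_linear g' using g by (rule has_derivative_bounded_linear)
  have n2: "norm (0::real, x, y) \<le> norm x + norm y" for x y :: 'a
    using norm_Pair_le[of "0::real" "(x, y)"] norm_Pair_le[of x y] by simp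
  \<comment> \<open>On the return the form is evaluated at an intermediate velocity shift of order
    \<open>s\<close>; a nonzero value here could add a term of order s^4, as large as the main
    terms.\<close>
  have Q'0: "Q' (0, 0, \<eta>) = 0"
  proof (rule third_derivative_zero[OF excess_derivs(1)[OF Q P0] excess_derivs(2)[OF Q P0]])
    have "((\<lambda>r. P 0 + (0, 0, r *\<^sub>R \<eta>)) has_vector_derivative (0, 0, \<eta>)) (at 0)"
      unfolding has_vector_derivative_def by (auto intro!: derivative_eq_intros)
    then show "((\<lambda>r. Q (P 0 + (0, 0, r *\<^sub>R \<eta>))) has_real_derivative Q' (0, 0, \<eta>)) (at 0)"
      using has_real_derivative_along[of "\<lambda>r. P 0 + (0, 0, r *\<^sub>R \<eta>)" "(0, 0, \<eta>)" 0 UNIV Q Q'] Q'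
      by (simp flip: zero_prod_def)
  qed (use Q0 excess_nonneg in \<open>auto simp flip: zero_prod_def\<close>)
  define A where "A = f' (P 0 + (0, 0, \<eta>)) (0, \<eta>, 0) - f' (P 0) (0, \<eta>, 0)"
  define B where "B = g' (0, 0, \<eta>)"
  define DQ where "DQ = Q' P'"
  obtain N where N: "N \<ge> 0" "\<And>x. \<bar>Q' x\<bar> \<le> N * norm x"
    using Q'.nonneg_bounded by (auto simp: mult.commute)
  \<comment> \<open>\<open>2 * K * s\<close> bounds the motion of the curve up to time
    \<open>2 * s\<close>, and \<open>C * s\<close> the distance from \<open>P 0\<close> of the
    arguments used on the return. \<open>C2\<close> collects the errors of the return:
    \<open>(C + 2 * N) / 2\<close> from the Taylor term, \<open>2 * C + 1\<close> from the mixed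
    term.\<close>
  define K where "K = norm P' + 1"
  define C where "C = 2 * K + 2 * norm \<eta>"
  define M where "M = \<bar>g' (0, \<eta>, 0)\<bar>"
  define C2 where "C2 = (C + 2 * N) / 2 + 2 * C + 1"
  have K: "K \<ge> 1" and C: "C \<ge> 2" and M: "M \<ge> 0" and C2: "C2 \<ge> 0"
    using N by (auto simp: K_def C_def M_def C2_def)
  have main: "0 \<le> \<sigma> * (A - B) + DE + DQ / 2 + \<kappa> * (2 + 2 * norm \<eta> + 2 * C2)"
    if \<kappa>: "0 < \<kappa>" "\<kappa> \<le> 1" for \<kappa>
  proof -
    obtain da where da: "da > 0" "\<And>\<tau>. 0 \<le> \<tau> \<Longrightarrow> \<tau> < da \<Longrightarrow> norm (P \<tau> - P 0 - \<tau> *\<^sub>R P') \<le> \<kappa> * \<tau>"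
      using has_vector_derivative_right_bound[OF P' \<kappa>(1)] by blast
    obtain db where db: "db > 0" "\<And>\<tau>. 0 \<le> \<tau> \<Longrightarrow> \<tau> < db \<Longrightarrow>
        norm (f (P \<tau> + (0, 0, \<eta>)) - f (P \<tau>) - f' (P \<tau>) (0, 0, \<eta>) - \<tau> * DE) \<le> \<kappa> * \<tau>"
      using has_vector_derivative_right_bound[OF e[unfolded has_real_derivative_iff_has_vector_derivative] \<kappa>(1)]
      by (auto simp: e0)
    obtain dc where dc: "dc > 0" "\<And>q. norm (q - P 0) < dc \<Longrightarrow>
        norm (f' q (0, \<eta>, 0) - f' (P 0) (0, \<eta>, 0) - g' (q - P 0)) \<le> \<kappa> * norm (q - P 0)"
      using has_derivative_bound[OF g \<kappa>(1)] by blast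
    obtain dd where dd: "dd > 0" "\<And>q. norm (q - P 0) < dd \<Longrightarrow>
        norm (Q q - Q' (q - P 0)) \<le> \<kappa> * norm (q - P 0)"
      using has_derivative_bound[OF Q' \<kappa>(1)] by (auto simp: Q0)
    obtain de where de: "de > 0" "de \<le> m0" "\<And>\<tau> x. 0 \<le> \<tau> \<Longrightarrow> \<tau> \<le> de \<Longrightarrow> norm x \<le> de \<Longrightarrow>
       dist (f' (P \<tau> + (0, x, \<eta>))) (f' (P 0 + (0, 0, \<eta>))) < \<kappa>"
      by (rule near_start[OF isCont_f'[OF shift_in[OF P0]] \<kappa>(1), of "\<eta>"]) (rule that)
    obtain df where df: "df > 0" "df \<le> m0" "\<And>\<tau> x. 0 \<le> \<tau> \<Longrightarrow> \<tau> \<le> df \<Longrightarrow> norm x \<le> df \<Longrightarrow>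
       dist (f' (P \<tau> + (0, x, 0))) (f' (P 0 + (0, 0, 0))) < \<kappa>"
      by (rule near_start[OF isCont_f'[OF shift_in[OF P0]] \<kappa>(1), of "0"]) (rule that)
    \<comment> \<open>The tent ends at time \<open>s * s + s\<close>, which is at most
      \<open>2 * s\<close>: hence \<open>s * 2\<close> in the conditions on time and
      \<open>s * C\<close> in those on the distance from \<open>P 0\<close>. The conditions on
      \<open>s * M\<close> and \<open>s * DQ\<close> absorb two leftovers of higher order.\<close>
    have "\<forall>\<^sub>F s in at_right 0. 0 < s \<and> s * 1 < 1 \<and> s * 2 < da \<and> s * 2 < db \<and> s * C < dc \<and> s * C < dd
       \<and> s * 1 < de \<and> s * 1 < df \<and> s * norm \<eta> < de \<and> s * M < \<kappa> \<and> s * DQ < \<kappa> \<and> s * 2 < m0 \<and> s * norm \<eta> < \<delta>"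
      by (intro eventually_conj eventually_at_right_scaled_le eventually_at_right_less)
         (use da db dc dd de df \<kappa> pos in auto)
    then obtain s where s: "0 < s" "s * 1 < 1" "s * 2 < da" "s * 2 < db" "s * C < dc" "s * C < dd"
       "s * 1 < de" "s * 1 < df" "s * norm \<eta> < de" "s * M < \<kappa>" "s * DQ < \<kappa>" "s * 2 < m0" "s * norm \<eta> < \<delta>"
      using eventually_happens'[OF trivial_limit_at_right_real] by blast
    have s2: "0 < s * s" "s * s \<le> s" using s(1,2) by (auto simp: mult_left_le_one_le)
    have PK: "norm (P \<tau> - P 0) \<le> 2 * K * s" if "0 \<le> \<tau>" "\<tau> \<le> 2 * s" for \<tau>
    proof -
      have "norm (P \<tau> - P 0) \<le> norm (P \<tau> - P 0 - \<tau> *\<^sub>R P') + norm (\<tau> *\<^sub>R P')"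
        using norm_triangle_ineq[of "P \<tau> - P 0 - \<tau> *\<^sub>R P'" "\<tau> *\<^sub>R P'"] by simp
      also have "\<dots> \<le> \<kappa> * \<tau> + \<tau> * norm P'" using da(2)[of \<tau>] that s by auto
      also have "\<dots> \<le> 1 * \<tau> + \<tau> * norm P'" using \<kappa> that by (intro add_right_mono mult_right_mono) auto
      also have "\<dots> = K * \<tau>" by (simp add: K_def algebra_simps)
      also have "\<dots> \<le> K * (2 * s)" using that K by (intro mult_left_mono) auto
      finally show ?thesis by simp
    qed
    define I1 where "I1 \<tau> = f (P \<tau> + (0, (\<sigma> * \<tau>) *\<^sub>R \<eta>, \<eta>)) - f (P \<tau>) - f' (P \<tau>) (0, (\<sigma> * \<tau>) *\<^sub>R \<eta>, \<eta>)" for \<tau>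
    define I2 where "I2 \<tau> = f (P \<tau> + (0, (\<sigma> * s * (s * s+s-\<tau>)) *\<^sub>R \<eta>, (- s) *\<^sub>R \<eta>)) - f (P \<tau>)
        - f' (P \<tau>) (0, (\<sigma> * s * (s * s+s-\<tau>)) *\<^sub>R \<eta>, (- s) *\<^sub>R \<eta>)" for \<tau>
    \<comment> \<open>The tent has both parameters equal to \<open>s\<close>: then \<open>f\<close> and \<open>Q\<close> contribute to its
      descending part with remainders \<open>o(s\<^sup>3)\<close>, and these are integrated over a length \<open>s\<close>.\<close>
    have split: "f' p (0, r *\<^sub>R \<eta>, t *\<^sub>R \<eta>) = r * f' p (0, \<eta>, 0) + t * f' p (0, 0, \<eta>)" for p r t
    proof -
      have "(0::real, r *\<^sub>R \<eta>, t *\<^sub>R \<eta>) = r *\<^sub>R (0, \<eta>, 0) + t *\<^sub>R (0, 0, \<eta>)" by simp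
      then show ?thesis by (simp only: blinfun.add_right blinfun.scaleR_right real_scaleR_def)
    qed
    \<comment> \<open>At the unmoved position the excess grows like \<open>\<tau> * DE\<close>; the
      displacement contributes \<open>\<sigma> * \<tau>\<close> times a difference of position
      derivatives that is close to \<open>A\<close>.\<close>
    have bound1: "I1 \<tau> \<le> 0 + (DE + \<sigma> * A + \<kappa> * (1 + 2 * norm \<eta>)) * \<tau>" if \<tau>: "\<tau> \<in> {0..s * s}" for \<tau>
    proof -
      have t0: "0 \<le> \<tau>" "\<tau> \<le> s" using \<tau> s2 by auto
      have Pt: "P \<tau> \<in> S \<times> UNIV" using P_in t0 s by auto
      obtain \<rho> where \<rho>: "\<bar>\<rho>\<bar> \<le> \<bar>\<sigma> * \<tau>\<bar>"
        "f (P \<tau> + (0, (\<sigma> * \<tau>) *\<^sub>R \<eta>, \<eta>)) - f (P \<tau> + (0, 0, \<eta>)) = (\<sigma> * \<tau>) * f' (P \<tau> + (0, \<rho> *\<^sub>R \<eta>, \<eta>)) (0, \<eta>, 0)"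
        by (rule mean_value_x[OF Pt, of "\<sigma> * \<tau>" \<eta> \<eta>])
      have \<rho>s: "\<bar>\<rho>\<bar> \<le> s" using \<rho>(1) sigma t0 by (simp add: abs_mult)
      have "norm (\<rho> *\<^sub>R \<eta>) \<le> s * norm \<eta>" using \<rho>s by (auto intro!: mult_right_mono)
      then have "dist (f' (P \<tau> + (0, \<rho> *\<^sub>R \<eta>, \<eta>))) (f' (P 0 + (0, 0, \<eta>))) < \<kappa>"
        using de(3)[of \<tau> "\<rho> *\<^sub>R \<eta>"] t0 s by auto
      moreover have "dist (f' (P \<tau>)) (f' (P 0)) < \<kappa>"
        using df(3)[of \<tau> 0] t0 s by (auto simp flip: zero_prod_def)
      ultimately have "norm ((f' (P \<tau> + (0, \<rho> *\<^sub>R \<eta>, \<eta>)) - f' (P 0 + (0, 0, \<eta>))) (0, \<eta>, 0)) \<le> \<kappa> * norm \<eta>"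
        and "norm ((f' (P \<tau>) - f' (P 0)) (0, \<eta>, 0)) \<le> \<kappa> * norm \<eta>"
        using norm_blinfun[of "f' (P \<tau> + (0, \<rho> *\<^sub>R \<eta>, \<eta>)) - f' (P 0 + (0, 0, \<eta>))" "(0, \<eta>, 0)"]
          norm_blinfun[of "f' (P \<tau>) - f' (P 0)" "(0, \<eta>, 0)"]
        by (auto simp: dist_norm norm_prod_def intro: order_trans[OF _ mult_right_mono])
      then have 1: "\<bar>f' (P \<tau> + (0, \<rho> *\<^sub>R \<eta>, \<eta>)) (0, \<eta>, 0) - f' (P \<tau>) (0, \<eta>, 0) - A\<bar> \<le> 2 * \<kappa> * norm \<eta>"
        by (auto simp: A_def blinfun.diff_left)
      let ?d = "f' (P \<tau> + (0, \<rho> *\<^sub>R \<eta>, \<eta>)) (0, \<eta>, 0) - f' (P \<tau>) (0, \<eta>, 0) - A"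
      have "\<sigma> * \<tau> * ?d \<le> \<bar>\<sigma> * \<tau> * ?d\<bar>" by simp
      also have "\<dots> \<le> \<tau> * (2 * \<kappa> * norm \<eta>)"
        using 1 t0 sigma by (auto simp: abs_mult intro!: mult_left_mono)
      finally have 2: "\<sigma> * \<tau> * ?d \<le> \<tau> * (2 * \<kappa> * norm \<eta>)" .
      have 3: "f (P \<tau> + (0, 0, \<eta>)) - f (P \<tau>) - f' (P \<tau>) (0, 0, \<eta>) \<le> \<tau> * DE + \<kappa> * \<tau>"
        using db(2)[of \<tau>] t0 s by (simp add: abs_le_iff)
      have "I1 \<tau> = (f (P \<tau> + (0, 0, \<eta>)) - f (P \<tau>) - f' (P \<tau>) (0, 0, \<eta>)) + \<sigma> * \<tau> * A + \<sigma> * \<tau> * ?d"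
        using \<rho>(2) split[of "P \<tau>" "\<sigma> * \<tau>" 1] by (simp add: I1_def algebra_simps)
      also have "\<dots> \<le> (\<tau> * DE + \<kappa> * \<tau>) + \<sigma> * \<tau> * A + \<tau> * (2 * \<kappa> * norm \<eta>)"
        using 2 3 by linarith
      finally show ?thesis by (simp add: algebra_simps)
    qed
    \<comment> \<open>The Taylor term of the excess at velocity shift \<open>- s\<close> yields
      \<open>s\<^sup>2 * DQ / 2 * \<tau>\<close>. The mixed term is \<open>- r * s * B\<close> with
      \<open>r\<close> the displacement, which is affine in \<open>\<tau>\<close>.\<close>
    have bound2: "I2 \<tau> \<le> (- \<sigma> * s\<^sup>2 * (s * s+s) * B + \<kappa> * C2 * s^3) + (s\<^sup>2 * DQ / 2 + \<sigma> * s\<^sup>2 * B) * \<tau>"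
      if \<tau>: "\<tau> \<in> {s * s..s * s+s}" for \<tau>
    proof -
      have t0: "0 \<le> \<tau>" "\<tau> \<le> 2 * s" using \<tau> s2 by auto
      have Pt: "P \<tau> \<in> S \<times> UNIV" using P_in t0 s by auto
      define r where "r = \<sigma> * s * (s * s+s-\<tau>)"
      have r: "\<bar>r\<bar> \<le> s * s" using \<tau> sigma s by (auto simp: r_def abs_mult intro!: mult_left_mono)
      have near: "norm (P \<tau> + (0, \<rho> *\<^sub>R \<eta>, t *\<^sub>R \<eta>) - P 0) \<le> C * s" if "\<bar>\<rho>\<bar> \<le> s" "\<bar>t\<bar> \<le> s" for \<rho> t
      proof -
        have "norm (P \<tau> + (0, \<rho> *\<^sub>R \<eta>, t *\<^sub>R \<eta>) - P 0) \<le> norm (P \<tau> - P 0) + norm (0::real, \<rho> *\<^sub>R \<eta>, t *\<^sub>R \<eta>)"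
          using norm_triangle_ineq[of "P \<tau> - P 0" "(0, \<rho> *\<^sub>R \<eta>, t *\<^sub>R \<eta>)"] by (simp add: algebra_simps)
        also have "\<dots> \<le> 2 * K * s + (s * norm \<eta> + s * norm \<eta>)"
          using PK[OF t0] n2[of "\<rho> *\<^sub>R \<eta>" "t *\<^sub>R \<eta>"] mult_right_mono[OF that(1), of "norm \<eta>"]
            mult_right_mono[OF that(2), of "norm \<eta>"] by simp
        finally show ?thesis by (simp add: C_def algebra_simps)
      qed
      have near0: "norm (P \<tau> - P 0) \<le> C * s" using near[of 0 0] s by (simp flip: zero_prod_def)
      obtain t where t: "\<bar>t\<bar> < \<bar>- s\<bar>" "f (P \<tau> + (0, 0, (- s) *\<^sub>R \<eta>)) - f (P \<tau>) - (- s) * f' (P \<tau>) (0, 0, \<eta>)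
          = Q (P \<tau> + (0, 0, t *\<^sub>R \<eta>)) / 2 * (- s)\<^sup>2"
        using Taylor_second_order[OF excess_derivs(1)[OF Q Pt] excess_derivs(2)[OF Q Pt], of "- s"] s(1)
        by (auto simp flip: zero_prod_def)
      let ?q = "P \<tau> + (0, 0, t *\<^sub>R \<eta>)"
      have nq: "norm (?q - P 0) \<le> C * s" using near[of 0 t] t s by simp
      have "Q' (?q - P 0) = Q' (P \<tau> - P 0 - \<tau> *\<^sub>R P') + \<tau> * DQ"
      proof -
        have "?q - P 0 = (P \<tau> - P 0 - \<tau> *\<^sub>R P') + (\<tau> *\<^sub>R P' + t *\<^sub>R (0, 0, \<eta>))" by simp
        then have "Q' (?q - P 0) = Q' ((P \<tau> - P 0 - \<tau> *\<^sub>R P') + (\<tau> *\<^sub>R P' + t *\<^sub>R (0, 0, \<eta>)))" by (rule arg_cong)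
        also have "\<dots> = Q' (P \<tau> - P 0 - \<tau> *\<^sub>R P') + \<tau> * DQ"
          by (simp only: Q'.add Q'.scaleR Q'0 DQ_def real_scaleR_def mult_zero_right add_0_right)
        finally show ?thesis .
      qed
      moreover have "Q' (P \<tau> - P 0 - \<tau> *\<^sub>R P') \<le> N * (\<kappa> * (2 * s))"
      proof -
        have "norm (P \<tau> - P 0 - \<tau> *\<^sub>R P') \<le> \<kappa> * (2 * s)"
          using da(2)[of \<tau>] t0 s \<kappa> by (auto intro: order_trans[OF _ mult_left_mono])
        then show ?thesis using N(2)[of "P \<tau> - P 0 - \<tau> *\<^sub>R P'"] mult_left_mono[OF _ N(1)] by fastforce
      qed
      moreover have "Q ?q \<le> Q' (?q - P 0) + \<kappa> * (C * s)"
      proof -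
        have "norm (Q ?q - Q' (?q - P 0)) \<le> \<kappa> * norm (?q - P 0)"
          by (rule dd(2)) (use nq s in \<open>auto simp: mult.commute\<close>)
        also have "\<dots> \<le> \<kappa> * (C * s)" using nq \<kappa> by (intro mult_left_mono) auto
        finally show ?thesis by (simp add: abs_le_iff)
      qed
      ultimately have "Q ?q \<le> \<tau> * DQ + \<kappa> * s * (C + 2 * N)" by (simp add: algebra_simps)
      then have first: "f (P \<tau> + (0, 0, (- s) *\<^sub>R \<eta>)) - f (P \<tau>) + s * f' (P \<tau>) (0, 0, \<eta>)
          \<le> (\<tau> * DQ + \<kappa> * s * (C + 2 * N)) / 2 * s\<^sup>2"
        using t(2) by (simp add: mult_right_mono)
      obtain \<rho> where \<rho>: "\<bar>\<rho>\<bar> \<le> \<bar>r\<bar>" "f (P \<tau> + (0, r *\<^sub>R \<eta>, (- s) *\<^sub>R \<eta>)) - f (P \<tau> + (0, 0, (- s) *\<^sub>R \<eta>))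
          = r * f' (P \<tau> + (0, \<rho> *\<^sub>R \<eta>, (- s) *\<^sub>R \<eta>)) (0, \<eta>, 0)"
        by (rule mean_value_x[OF Pt, of r \<eta> "(- s) *\<^sub>R \<eta>"])
      let ?q1 = "P \<tau> + (0, \<rho> *\<^sub>R \<eta>, (- s) *\<^sub>R \<eta>)"
      have \<rho>s: "\<bar>\<rho>\<bar> \<le> s * s" "\<bar>\<rho>\<bar> \<le> s" using \<rho>(1) r s2 by auto
      have nq1: "norm (?q1 - P 0) \<le> C * s" using near[of \<rho> "- s"] \<rho>s s by simp
      have g1: "\<bar>f' ?q1 (0, \<eta>, 0) - f' (P 0) (0, \<eta>, 0) - g' (?q1 - P 0)\<bar> \<le> \<kappa> * (C * s)"
      proof -
        have "norm (f' ?q1 (0, \<eta>, 0) - f' (P 0) (0, \<eta>, 0) - g' (?q1 - P 0)) \<le> \<kappa> * norm (?q1 - P 0)"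
          by (rule dc(2)) (use nq1 s in \<open>auto simp: mult.commute\<close>)
        also have "\<dots> \<le> \<kappa> * (C * s)" using nq1 \<kappa> by (intro mult_left_mono) auto
        finally show ?thesis by simp
      qed
      have g2: "\<bar>f' (P \<tau>) (0, \<eta>, 0) - f' (P 0) (0, \<eta>, 0) - g' (P \<tau> - P 0)\<bar> \<le> \<kappa> * (C * s)"
      proof -
        have "norm (f' (P \<tau>) (0, \<eta>, 0) - f' (P 0) (0, \<eta>, 0) - g' (P \<tau> - P 0)) \<le> \<kappa> * norm (P \<tau> - P 0)"
          by (rule dc(2)) (use near0 s in \<open>auto simp: mult.commute\<close>)
        also have "\<dots> \<le> \<kappa> * (C * s)" using near0 \<kappa> by (intro mult_left_mono) auto
        finally show ?thesis by simp
      qed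
      \<comment> \<open>The position derivative is expanded around \<open>P 0\<close> only, so the
        two points are compared through that base point. The motion of the curve, itself of order
        \<open>s\<close>, cancels in the difference, and the velocity shift leaves
        \<open>- s * B\<close>.\<close>
      have g3: "g' (?q1 - P 0) - g' (P \<tau> - P 0) = \<rho> * g' (0, \<eta>, 0) - s * B"
      proof -
        have "?q1 - P 0 = (P \<tau> - P 0) + (\<rho> *\<^sub>R (0, \<eta>, 0) + (- s) *\<^sub>R (0, 0, \<eta>))" by simp
        then have "g' (?q1 - P 0) = g' ((P \<tau> - P 0) + (\<rho> *\<^sub>R (0, \<eta>, 0) + (- s) *\<^sub>R (0, 0, \<eta>)))" by (rule arg_cong)
        also have "\<dots> = g' (P \<tau> - P 0) + (\<rho> * g' (0, \<eta>, 0) + (- s) * B)"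
          by (simp only: g'.add g'.scaleR B_def real_scaleR_def)
        finally show ?thesis by simp
      qed
      \<comment> \<open>The displacement is of order s^2, one order below the term
        \<open>s * B\<close>.\<close>
      have g4: "\<bar>\<rho> * g' (0, \<eta>, 0)\<bar> \<le> s * \<kappa>"
      proof -
        have "\<bar>\<rho> * g' (0, \<eta>, 0)\<bar> \<le> (s * s) * M" unfolding abs_mult M_def using \<rho>s by (intro mult_right_mono) auto
        also have "\<dots> \<le> s * \<kappa>" using s by (simp add: mult.assoc)
        finally show ?thesis .
      qed
      let ?d = "f' ?q1 (0, \<eta>, 0) - f' (P \<tau>) (0, \<eta>, 0) + s * B"
      have "\<bar>?d\<bar> \<le> \<kappa> * s * (2 * C + 1)"
        using g1 g2 g3 g4 by (simp add: algebra_simps abs_le_iff)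
      then have "\<bar>r * ?d\<bar> \<le> (s * s) * (\<kappa> * s * (2 * C + 1))"
        unfolding abs_mult using r s2 by (intro mult_mono) auto
      then have second: "r * ?d \<le> (s * s) * (\<kappa> * s * (2 * C + 1))" by simp
      have "I2 \<tau> = (f (P \<tau> + (0, 0, (- s) *\<^sub>R \<eta>)) - f (P \<tau>) + s * f' (P \<tau>) (0, 0, \<eta>)) + r * ?d - r * s * B"
      proof -
        have "I2 \<tau> = f (P \<tau> + (0, r *\<^sub>R \<eta>, (- s) *\<^sub>R \<eta>)) - f (P \<tau>) - f' (P \<tau>) (0, r *\<^sub>R \<eta>, (- s) *\<^sub>R \<eta>)"
          by (simp only: I2_def r_def)
        then show ?thesis using \<rho>(2) split[of "P \<tau>" r "- s"] by (simp add: algebra_simps)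
      qed
      also have "\<dots> \<le> (\<tau> * DQ + \<kappa> * s * (C + 2 * N)) / 2 * s\<^sup>2 + (s * s) * (\<kappa> * s * (2 * C + 1)) - r * s * B"
        using first second by linarith
      also have "\<dots> = (- \<sigma> * s\<^sup>2 * (s * s+s) * B + \<kappa> * C2 * s^3) + (s\<^sup>2 * DQ / 2 + \<sigma> * s\<^sup>2 * B) * \<tau>"
        unfolding C2_def r_def by (simp add: field_simps power2_eq_square power3_eq_cube)
      finally show ?thesis .
    qed
    have small: "s * s + s \<le> m0" "s * s \<le> m0" "s * s * norm \<eta> \<le> \<delta>"
    proof -
      show "s * s + s \<le> m0" "s * s \<le> m0" using s2 s(1,12) by linarith+
      have "s * s * norm \<eta> \<le> s * norm \<eta>" using s2 by (intro mult_right_mono) auto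
      then show "s * s * norm \<eta> \<le> \<delta>" using s(13) by linarith
    qed
    have i1: "(\<lambda>\<tau>. f (P \<tau> + (0, (\<sigma> * \<tau>) *\<^sub>R \<eta>, \<eta>)) - f (P \<tau>)) integrable_on {0..s * s}"
      and i2: "(\<lambda>\<tau>. f (P \<tau> + (0, (\<sigma> * s * (s * s+s-\<tau>)) *\<^sub>R \<eta>, (- s) *\<^sub>R \<eta>)) - f (P \<tau>)) integrable_on {s * s..s * s+s}"
      by (intro integrable_continuous_real continuous_intros continuous_along continuous_along0;
          use isCont_f small s s2 in auto)+
    have cf': "continuous_on {l..u} (\<lambda>\<tau>. f' (P \<tau>))" if "{l..u} \<subseteq> {0..m0}" for l u
      by (rule continuous_along0) (use isCont_f' that in auto)
    have i3: "(\<lambda>\<tau>. f' (P \<tau>) (0, (\<sigma> * \<tau>) *\<^sub>R \<eta>, \<eta>)) integrable_on {0..s * s}"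
      and i4: "(\<lambda>\<tau>. f' (P \<tau>) (0, (\<sigma> * s * (s * s+s-\<tau>)) *\<^sub>R \<eta>, (- s) *\<^sub>R \<eta>)) integrable_on {s * s..s * s+s}"
      by (intro integrable_continuous_real bounded_bilinear.continuous_on[OF bounded_bilinear_blinfun_apply]
          cf' continuous_intros; use small s s2 in auto)+
    have I1: "I1 integrable_on {0..s * s}" and I2: "I2 integrable_on {s * s..s * s+s}"
      unfolding I1_def I2_def by (intro integrable_diff i1 i2 i3 i4)+
    \<comment> \<open>The linear terms integrate to exactly 0 by the Euler equation, so subtracting
      them does not change the increment.\<close>
    have "0 \<le> integral {0..s * s} I1 + integral {s * s..s * s+s} I2"
      using variation[OF s(1) s(1) small(1,3)] euler[OF s(1) s(1) small(1), of \<eta>]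
      unfolding I1_def I2_def Henstock_Kurzweil_Integration.integral_diff[OF i1 i3]
        Henstock_Kurzweil_Integration.integral_diff[OF i2 i4] by linarith
    also have "\<dots> \<le> (0 * (s * s - 0) + (DE + \<sigma> * A + \<kappa> * (1 + 2 * norm \<eta>)) * ((s * s)\<^sup>2 - 0\<^sup>2) / 2) +
       ((- \<sigma> * s\<^sup>2 * (s * s+s) * B + \<kappa> * C2 * s^3) * (s * s+s - s * s)
         + (s\<^sup>2 * DQ / 2 + \<sigma> * s\<^sup>2 * B) * ((s * s+s)\<^sup>2 - (s * s)\<^sup>2) / 2)"
      by (intro add_mono integral_le_affine I1 I2 bound1 bound2) (use s s2 in auto)
    \<comment> \<open>On the return half the difference of squares is s^2/2 + s^3: besides
      \<open>DQ / 2\<close> it leaves \<open>s * DQ\<close>, which is below \<open>\<kappa>\<close>,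
      while for \<open>B\<close> the terms in s^5 cancel exactly.\<close>
    also have "\<dots> = s^4 / 2 * (\<sigma> * (A - B) + DE + DQ / 2 + s * DQ + \<kappa> * (1 + 2 * norm \<eta> + 2 * C2))"
      by (simp add: field_simps power2_eq_square power3_eq_cube power4_eq_xxxx)
    finally have "0 \<le> \<sigma> * (A - B) + DE + DQ / 2 + s * DQ + \<kappa> * (1 + 2 * norm \<eta> + 2 * C2)"
      using s(1) by (simp add: zero_le_mult_iff)
    then show ?thesis using s(11) by (simp add: algebra_simps)
  qed
  have "0 \<le> \<sigma> * (A - B) + DE + DQ / 2"
  proof (rule field_le_epsilon)
    fix \<epsilon> :: real assume "\<epsilon> > 0"
    define c where "c = 2 + 2 * norm \<eta> + 2 * C2"
    have c: "c > 0" using C2 by (auto simp: c_def intro!: add_pos_nonneg)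
    have "0 < min 1 (\<epsilon> / c)" using \<open>\<epsilon> > 0\<close> c by simp
    from main[OF this] have "0 \<le> \<sigma> * (A - B) + DE + DQ / 2 + min 1 (\<epsilon> / c) * c" by (simp add: c_def)
    also have "min 1 (\<epsilon> / c) * c \<le> \<epsilon> / c * c" using c by (intro mult_right_mono) auto
    finally show "0 \<le> \<sigma> * (A - B) + DE + DQ / 2 + \<epsilon>" using c by simp
  qed
  then show ?thesis by (simp add: A_def B_def DQ_def)
qed

end

subsection \<open>Piecewise smooth curves\<close>

lemma eventually_not_mem_finite:
  fixes A :: "real set"
  assumes "finite A"
  shows "\<forall>\<^sub>F s in at t. s \<notin> A"
  using islimpt_finite[OF assms, of t] by (simp add: islimpt_iff_eventually)

lemma eventually_interior_right:
  fixes t t0 t1 :: real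
  assumes "finite A" "t \<in> {t0..<t1}"
  shows "\<forall>\<^sub>F s in at_right t. s \<in> {t0<..<t1} - A"
proof -
  have "\<forall>\<^sub>F s in at_right t. s \<notin> A"
    using eventually_not_mem_finite[OF assms(1), of t] at_le[of "{t<..}" UNIV t] by (auto elim: filter_leD)
  moreover have "\<forall>\<^sub>F s in at_right t. s \<in> {t<..<t1}"
    using assms(2) by (intro eventually_at_right_real) auto
  ultimately show ?thesis by eventually_elim (use assms(2) in auto)
qed

lemma eventually_interior_left:
  fixes t t0 t1 :: real
  assumes "finite A" "t \<in> {t0<..t1}"
  shows "\<forall>\<^sub>F s in at_left t. s \<in> {t0<..<t1} - A"
proof -
  have "\<forall>\<^sub>F s in at_left t. s \<notin> A"
    using eventually_not_mem_finite[OF assms(1), of t] at_le[of "{..<t}" UNIV t] by (auto elim: filter_leD)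
  moreover have "\<forall>\<^sub>F s in at_left t. s \<in> {t0<..<t}"
    using assms(2) by (intro eventually_at_left_real) auto
  ultimately show ?thesis by eventually_elim (use assms(2) in auto)
qed

lemma not_angularD:
  assumes "t \<in> {t0<..<t1} - angular_points t0 t1 x"
  shows "x differentiable (at t)" "isCont (velocity x) t"
  using assms by (auto simp: angular_points_def)

lemma KC1_finite: "x \<in> KC1 t0 t1 \<Longrightarrow> finite (angular_points t0 t1 x)"
  and KC1_continuous: "x \<in> KC1 t0 t1 \<Longrightarrow> continuous_on {t0..t1} x"
  by (auto simp: KC1_def)

lemma KC1_right_limit:
  assumes "x \<in> KC1 t0 t1" "t \<in> {t0..<t1}"
  shows "\<exists>l. (velocity x \<longlongrightarrow> l) (at_right t)"
proof (cases "t \<in> {t0} \<union> angular_points t0 t1 x")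
  case True
  then show ?thesis using assms(1) by (auto simp: KC1_def)
next
  case False
  then have "isCont (velocity x) t" using not_angularD(2)[of t t0 t1 x] assms(2) by auto
  then show ?thesis unfolding isCont_def using tendsto_mono[OF at_le] by blast
qed

lemma KC1_left_limit:
  assumes "x \<in> KC1 t0 t1" "t \<in> {t0<..t1}"
  shows "\<exists>l. (velocity x \<longlongrightarrow> l) (at_left t)"
proof (cases "t \<in> angular_points t0 t1 x \<union> {t1}")
  case True
  then show ?thesis using assms(1) by (auto simp: KC1_def)
next
  case False
  then have "isCont (velocity x) t" using not_angularD(2)[of t t0 t1 x] assms(2) by auto
  then show ?thesis unfolding isCont_def using tendsto_mono[OF at_le] by blast
qed

text \<open>Corners of the summands may cancel, hence only an inclusion of angular points. The
  one-sided limits add because velocities add on a punctured one-sided neighbourhood.\<close>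

lemma KC1_add:
  assumes x: "x \<in> KC1 t0 t1" and y: "y \<in> KC1 t0 t1" and "t0 < t1"
  shows "(\<lambda>t. x t + y t) \<in> KC1 t0 t1" (is "?z \<in> _")
    and "angular_points t0 t1 (\<lambda>t. x t + y t) \<subseteq> angular_points t0 t1 x \<union> angular_points t0 t1 y"
proof -
  let ?A = "angular_points t0 t1 x \<union> angular_points t0 t1 y"
  have fin: "finite ?A" using x y by (simp add: KC1_finite)
  \<comment> \<open>only off \<open>?A\<close>: where a curve is not differentiable its velocity is an arbitrary value\<close>
  have vel: "velocity ?z t = velocity x t + velocity y t" if "t \<in> {t0<..<t1} - ?A" for t
    using not_angularD(1)[of t t0 t1 x] not_angularD(1)[of t t0 t1 y] that
    unfolding velocity_def by (intro vector_derivative_add_at) auto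
  have op: "open ({t0<..<t1} - ?A)" using fin by (intro open_Diff finite_imp_closed) auto
  show sub: "angular_points t0 t1 ?z \<subseteq> ?A"
  proof
    fix t assume t: "t \<in> angular_points t0 t1 ?z"
    show "t \<in> ?A"
    proof (rule ccontr)
      assume n: "t \<notin> ?A"
      then have t': "t \<in> {t0<..<t1} - ?A" using t by (auto simp: angular_points_def)
      then have r: "x differentiable (at t)" "isCont (velocity x) t" "y differentiable (at t)" "isCont (velocity y) t"
        using not_angularD[of t t0 t1 x] not_angularD[of t t0 t1 y] by auto
      have "\<forall>\<^sub>F s in nhds t. velocity ?z s = velocity x s + velocity y s"
        using vel eventually_nhds_in_open[OF op t'] by (auto elim: eventually_mono)
      then have "isCont (velocity ?z) t" by (rule isCont_cong[THEN iffD2]) (intro isCont_add r)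
      then show False using t r by (auto simp: angular_points_def)
    qed
  qed
  have right: "\<exists>l. (velocity ?z \<longlongrightarrow> l) (at_right t)" if t: "t \<in> {t0..<t1}" for t
  proof -
    obtain k l where "(velocity x \<longlongrightarrow> k) (at_right t)" "(velocity y \<longlongrightarrow> l) (at_right t)"
      using KC1_right_limit x y t by metis
    then have "((\<lambda>s. velocity x s + velocity y s) \<longlongrightarrow> k + l) (at_right t)" by (rule tendsto_add)
    moreover have "\<forall>\<^sub>F s in at_right t. velocity x s + velocity y s = velocity ?z s"
      using eventually_interior_right[OF fin t] vel by (auto elim: eventually_mono)
    ultimately show ?thesis using Lim_transform_eventually by blast
  qed
  have left: "\<exists>l. (velocity ?z \<longlongrightarrow> l) (at_left t)" if t: "t \<in> {t0<..t1}" for t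
  proof -
    obtain k l where "(velocity x \<longlongrightarrow> k) (at_left t)" "(velocity y \<longlongrightarrow> l) (at_left t)"
      using KC1_left_limit x y t by metis
    then have "((\<lambda>s. velocity x s + velocity y s) \<longlongrightarrow> k + l) (at_left t)" by (rule tendsto_add)
    moreover have "\<forall>\<^sub>F s in at_left t. velocity x s + velocity y s = velocity ?z s"
      using eventually_interior_left[OF fin t] vel by (auto elim: eventually_mono)
    ultimately show ?thesis using Lim_transform_eventually by blast
  qed
  have "angular_points t0 t1 ?z \<subseteq> {t0<..<t1}" by (auto simp: angular_points_def)
  then show "?z \<in> KC1 t0 t1"
    unfolding KC1_def
    using finite_subset[OF sub fin] KC1_continuous[OF x] KC1_continuous[OF y] right left \<open>t0 < t1\<close>
    by (auto intro!: continuous_intros)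
qed

section \<open>Ramps, tents and the variations they generate\<close>

text \<open>A function with a single corner; the sign of \<open>\<sigma>\<close> selects the side on
  which it is nonzero. A tent is a sum of three ramps, so its piecewise smoothness reduces to that
  of one corner.\<close>

definition ramp :: "real \<Rightarrow> real \<Rightarrow> 'a::real_normed_vector \<Rightarrow> real \<Rightarrow> 'a" where
  "ramp \<sigma> c \<zeta> t = max 0 (\<sigma> * (t - c)) *\<^sub>R \<zeta>"

lemma ramp_has_vector_derivative:
  assumes "\<sigma> * (t - c) \<noteq> 0"
  shows "(ramp \<sigma> c \<zeta> has_vector_derivative (if \<sigma> * (t - c) > 0 then \<sigma> *\<^sub>R \<zeta> else 0)) (at t)"
proof (cases "\<sigma> * (t - c) > 0")
  case True
  have "((\<lambda>t. (\<sigma> * (t - c)) *\<^sub>R \<zeta>) has_vector_derivative \<sigma> *\<^sub>R \<zeta>) (at t)"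
    unfolding has_vector_derivative_def by (auto intro!: derivative_eq_intros simp: mult.commute)
  moreover have "open {t. \<sigma> * (t - c) > 0}" by (intro open_Collect_less continuous_intros)
  ultimately have "(ramp \<sigma> c \<zeta> has_vector_derivative \<sigma> *\<^sub>R \<zeta>) (at t)"
    by (rule has_vector_derivative_transform_within_open) (use True in \<open>simp_all add: ramp_def\<close>)
  then show ?thesis using True by simp
next
  case False
  then have neg: "\<sigma> * (t - c) < 0" using assms by linarith
  have "((\<lambda>t. 0) has_vector_derivative (0::'a)) (at t)" by simp
  moreover have "open {t. \<sigma> * (t - c) < 0}" by (intro open_Collect_less continuous_intros)
  ultimately have "(ramp \<sigma> c \<zeta> has_vector_derivative 0) (at t)"
    by (rule has_vector_derivative_transform_within_open) (use neg in \<open>simp_all add: ramp_def\<close>)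
  then show ?thesis using False by simp
qed

text \<open>The velocity is constant on either side of \<open>c\<close>. There may be no angular
  point at all, since \<open>c\<close> can lie outside the interval and \<zeta> can be 0.\<close>

lemma ramp_KC1:
  assumes "\<sigma> \<noteq> 0" "t0 < t1"
  shows "ramp \<sigma> c \<zeta> \<in> KC1 t0 t1" and "angular_points t0 t1 (ramp \<sigma> c \<zeta>) \<subseteq> {c}"
proof -
  have vel: "velocity (ramp \<sigma> c \<zeta>) t = (if \<sigma> * (t - c) > 0 then \<sigma> *\<^sub>R \<zeta> else 0)" if "t \<noteq> c" for t
    unfolding velocity_def
    by (rule vector_derivative_at, rule ramp_has_vector_derivative) (use that assms in auto)
  have less: "\<sigma> * (s - c) > 0 \<longleftrightarrow> \<sigma> < 0" if "s < c" for s
    using that by (auto simp: zero_less_mult_iff)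
  have greater: "\<sigma> * (s - c) > 0 \<longleftrightarrow> \<sigma> > 0" if "s > c" for s
    using that by (auto simp: zero_less_mult_iff)
  define v1 where "v1 = (if \<sigma> < 0 then \<sigma> *\<^sub>R \<zeta> else 0)"
  define v2 where "v2 = (if \<sigma> > 0 then \<sigma> *\<^sub>R \<zeta> else 0)"
  have v1: "velocity (ramp \<sigma> c \<zeta>) s = v1" if "s < c" for s using vel[of s] less[OF that] that by (auto simp: v1_def)
  have v2: "velocity (ramp \<sigma> c \<zeta>) s = v2" if "s > c" for s using vel[of s] greater[OF that] that by (auto simp: v2_def)
  show sub: "angular_points t0 t1 (ramp \<sigma> c \<zeta>) \<subseteq> {c}"
  proof
    fix t assume t: "t \<in> angular_points t0 t1 (ramp \<sigma> c \<zeta>)"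
    have "isCont (velocity (ramp \<sigma> c \<zeta>)) t" if "t \<noteq> c"
    proof (cases "t < c")
      case True
      then have "\<forall>\<^sub>F s in nhds t. velocity (ramp \<sigma> c \<zeta>) s = v1"
        using v1 eventually_nhds_in_open[of "{..<c}" t] by (auto elim: eventually_mono)
      then show ?thesis by (rule isCont_cong[THEN iffD2]) (rule continuous_const)
    next
      case False
      then have "\<forall>\<^sub>F s in nhds t. velocity (ramp \<sigma> c \<zeta>) s = v2"
        using v2 eventually_nhds_in_open[of "{c<..}" t] that by (auto elim: eventually_mono)
      then show ?thesis by (rule isCont_cong[THEN iffD2]) (rule continuous_const)
    qed
    moreover have "ramp \<sigma> c \<zeta> differentiable (at t)" if "t \<noteq> c"
      using ramp_has_vector_derivative[of \<sigma> t c \<zeta>] that assms by (auto intro: differentiableI_vector)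
    ultimately show "t \<in> {c}" using t by (auto simp: angular_points_def)
  qed
  have right: "\<exists>l. (velocity (ramp \<sigma> c \<zeta>) \<longlongrightarrow> l) (at_right t)" for t
  proof (cases "t < c")
    case True
    then have "\<forall>\<^sub>F s in at_right t. velocity (ramp \<sigma> c \<zeta>) s = v1"
      using v1 eventually_at_right_real[of t c] by (auto elim: eventually_mono)
    then show ?thesis using tendsto_eventually by blast
  next
    case False
    then have "\<forall>\<^sub>F s in at_right t. velocity (ramp \<sigma> c \<zeta>) s = v2"
      using v2 eventually_at_right_less[of t] by (auto elim!: eventually_mono)
    then show ?thesis using tendsto_eventually by blast
  qed
  have left: "\<exists>l. (velocity (ramp \<sigma> c \<zeta>) \<longlongrightarrow> l) (at_left t)" for t
  proof (cases "t > c")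
    case True
    then have "\<forall>\<^sub>F s in at_left t. velocity (ramp \<sigma> c \<zeta>) s = v2"
      using v2 eventually_at_left_real[of c t] by (auto elim: eventually_mono)
    then show ?thesis using tendsto_eventually by blast
  next
    case False
    then have "\<forall>\<^sub>F s in at_left t. velocity (ramp \<sigma> c \<zeta>) s = v1"
      using v1 eventually_at_left_real[of "t - 1" t] by (auto elim!: eventually_mono)
    then show ?thesis using tendsto_eventually by blast
  qed
  have "continuous_on {t0..t1} (ramp \<sigma> c \<zeta>)"
    unfolding ramp_def by (intro continuous_intros)
  then show "ramp \<sigma> c \<zeta> \<in> KC1 t0 t1"
    unfolding KC1_def using finite_subset[OF sub] right left by auto
qed

text \<open>The one-sided limits bound the velocity near each point, and bisection makes the bound
  global. At a corner or an end point the value itself is unrelated to these limits and enters the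
  local bound separately.\<close>

lemma KC1_bounded_velocity:
  assumes x: "x \<in> KC1 t0 t1" and "t0 < t1"
  shows "bounded (velocity x ` {t0..t1})"
proof -
  have "bounded (velocity x ` ({t0..t1} \<inter> {t0..t1}))"
  proof (rule Bolzano[where P="\<lambda>a b. bounded (velocity x ` ({a..b} \<inter> {t0..t1}))"])
    show "t0 \<le> t1" using assms by simp
    fix a b c :: real
    assume "bounded (velocity x ` ({a..b} \<inter> {t0..t1}))" "bounded (velocity x ` ({b..c} \<inter> {t0..t1}))" "a \<le> b" "b \<le> c"
    moreover from this have "{a..c} = {a..b} \<union> {b..c}" by auto
    ultimately show "bounded (velocity x ` ({a..c} \<inter> {t0..t1}))"
      by (simp add: Int_Un_distrib2 image_Un)
  next
    fix t assume t: "t0 \<le> t" "t \<le> t1"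
    obtain dr Br where dr: "dr > 0" "\<And>s. t < s \<Longrightarrow> s < t + dr \<Longrightarrow> s \<le> t1 \<Longrightarrow> norm (velocity x s) \<le> Br"
    proof (cases "t < t1")
      case True
      then obtain l where "(velocity x \<longlongrightarrow> l) (at_right t)" using KC1_right_limit[OF x, of t] t by auto
      then have "\<forall>\<^sub>F s in at_right t. norm (velocity x s) < norm l + 1"
        by (intro order_tendstoD[OF tendsto_norm]) auto
      then obtain b where "b > t" "\<And>s. t < s \<Longrightarrow> s < b \<Longrightarrow> norm (velocity x s) < norm l + 1"
        unfolding eventually_at_right_field by blast
      then show thesis using that[of "b - t" "norm l + 1"] by (auto intro: less_imp_le)
    \<comment> \<open>At \<open>t = t1\<close> no point of the interval lies to the right, so any
      radius and any bound will do.\<close>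
    qed (use that[of 1 0] in auto)
    obtain dl Bl where dl: "dl > 0" "\<And>s. s < t \<Longrightarrow> s > t - dl \<Longrightarrow> s \<ge> t0 \<Longrightarrow> norm (velocity x s) \<le> Bl"
    proof (cases "t > t0")
      case True
      then obtain l where "(velocity x \<longlongrightarrow> l) (at_left t)" using KC1_left_limit[OF x, of t] t by auto
      then have "\<forall>\<^sub>F s in at_left t. norm (velocity x s) < norm l + 1"
        by (intro order_tendstoD[OF tendsto_norm]) auto
      then obtain b where "b < t" "\<And>s. b < s \<Longrightarrow> s < t \<Longrightarrow> norm (velocity x s) < norm l + 1"
        unfolding eventually_at_left_field by blast
      then show thesis using that[of "t - b" "norm l + 1"] by (auto intro: less_imp_le)
    qed (use that[of 1 0] in auto)
    show "\<exists>d>0. \<forall>a b. a \<le> t \<and> t \<le> b \<and> b - a < d \<longrightarrow> bounded (velocity x ` ({a..b} \<inter> {t0..t1}))"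
    proof (intro exI[of _ "min dr dl"] conjI allI impI)
      fix a b assume ab: "a \<le> t \<and> t \<le> b \<and> b - a < min dr dl"
      have "norm (velocity x s) \<le> max (norm (velocity x t)) (max Br Bl)" if "s \<in> {a..b} \<inter> {t0..t1}" for s
        using dr(2)[of s] dl(2)[of s] that ab by (cases "s = t"; cases "s < t") auto
      then show "bounded (velocity x ` ({a..b} \<inter> {t0..t1}))" unfolding bounded_iff by blast
    qed (use dr dl in auto)
  qed
  then show ?thesis by simp
qed

text \<open>Off a finite set the integrand is continuous, and it is bounded because time, position
  and velocity stay in a compact set; finitely many points are negligible.\<close>

lemma KC1_integrable:
  fixes x :: "real \<Rightarrow> 'a::euclidean_space" and f :: "real \<times> 'a \<times> 'a \<Rightarrow> real"
  assumes x: "x \<in> KC1 t0 t1" and "t0 < t1" and f: "continuous_on ({t0..t1} \<times> UNIV) f"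
  shows "(\<lambda>t. f (t, x t, velocity x t)) integrable_on {t0..t1}"
proof -
  let ?A = "angular_points t0 t1 x"
  let ?S = "{t0<..<t1} - ?A"
  let ?g = "\<lambda>t. f (t, x t, velocity x t)"
  have fin: "finite ?A" using x by (rule KC1_finite)
  have op: "open ?S" using fin by (intro open_Diff finite_imp_closed) auto
  obtain B where B: "\<And>t. t \<in> {t0..t1} \<Longrightarrow> norm (velocity x t) \<le> B"
    using KC1_bounded_velocity[OF x \<open>t0 < t1\<close>] unfolding bounded_iff by blast
  let ?K = "{t0..t1} \<times> x ` {t0..t1} \<times> (cball 0 B :: 'a set)"
  have "compact ?K"
    using KC1_continuous[OF x] by (intro compact_Times compact_continuous_image) auto
  then have "compact (f ` ?K)"
    using f by (intro compact_continuous_image) (auto elim!: continuous_on_subset)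
  then have "bounded (f ` ?K)" by (rule compact_imp_bounded)
  then obtain C where "\<forall>y\<in>f ` ?K. norm y \<le> C" unfolding bounded_iff ..
  then have C: "norm (f p) \<le> C" if "p \<in> ?K" for p using that by blast
  have cx: "continuous_on ?S x" by (rule continuous_on_subset[OF KC1_continuous[OF x]]) auto
  have cv: "continuous_on ?S (velocity x)"
    by (rule continuous_at_imp_continuous_on) (use not_angularD(2) in blast)
  have "continuous_on ?S (\<lambda>t. (t, x t, velocity x t))" by (intro continuous_intros cx cv)
  then have cg: "continuous_on ?S ?g" by (rule continuous_on_compose2[OF f]) auto
  have neg: "negligible ({t0..t1} - ?S)"
    by (rule negligible_finite, rule finite_subset[of _ "{t0, t1} \<union> ?A"]) (use fin in auto)
  have "?g integrable_on ?S"
  proof (rule measurable_bounded_by_integrable_imp_integrable)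
    show "?g \<in> borel_measurable (lebesgue_on ?S)"
      using cg op by (intro continuous_imp_measurable_on_sets_lebesgue) auto
    have "(\<lambda>_. C) integrable_on {t0..t1}" by (rule integrable_const_ivl)
    then show "(\<lambda>_. C) integrable_on ?S"
      by (rule integrable_spike_set[OF _ negligible_subset[OF neg] empty_imp_negligible]) auto
    show "norm (?g t) \<le> C" if "t \<in> ?S" for t
      using that B[of t] by (intro C) auto
    show "?S \<in> sets lebesgue" using op by auto
  qed
  then show ?thesis
    by (rule integrable_spike_set[OF _ empty_imp_negligible negligible_subset[OF neg]]) auto
qed

text \<open>The slope changes by 1, \<open>- (1 + s)\<close> and \<open>s\<close>, with sum 0. The
  height \<open>s * m\<close> reached after time \<open>s * m\<close> is consumed at slope
  \<open>- s\<close> in time \<open>m\<close>, so the function is 0 from then on.\<close>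

definition tent :: "real \<Rightarrow> real \<Rightarrow> real \<Rightarrow> real" where
  "tent s m \<tau> = max 0 \<tau> - (1 + s) * max 0 (\<tau> - s * m) + s * max 0 (\<tau> - (s * m + m))"

lemma tent_values:
  assumes "s > 0" "m > 0"
  shows "\<tau> \<le> 0 \<Longrightarrow> tent s m \<tau> = 0"
    and "0 \<le> \<tau> \<Longrightarrow> \<tau> \<le> s * m \<Longrightarrow> tent s m \<tau> = \<tau>"
    and "s * m \<le> \<tau> \<Longrightarrow> \<tau> \<le> s * m + m \<Longrightarrow> tent s m \<tau> = s * (s * m + m - \<tau>)"
    and "s * m + m \<le> \<tau> \<Longrightarrow> tent s m \<tau> = 0"
proof -
  have sm: "s * m > 0" using assms by simp
  show "tent s m \<tau> = 0" if "\<tau> \<le> 0"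
  proof -
    have "max 0 (\<tau>) = 0" by (rule max_absorb1) (use that sm assms in linarith)
    moreover have "max 0 (\<tau> - s * m) = 0" by (rule max_absorb1) (use that sm assms in linarith)
    moreover have "max 0 (\<tau> - (s * m + m)) = 0" by (rule max_absorb1) (use that sm assms in linarith)
    ultimately show ?thesis by (simp add: tent_def algebra_simps)
  qed
  show "tent s m \<tau> = \<tau>" if "0 \<le> \<tau>" "\<tau> \<le> s * m"
  proof -
    have "max 0 (\<tau>) = \<tau>" by (rule max_absorb2) (use that sm assms in linarith)
    moreover have "max 0 (\<tau> - s * m) = 0" by (rule max_absorb1) (use that sm assms in linarith)
    moreover have "max 0 (\<tau> - (s * m + m)) = 0" by (rule max_absorb1) (use that sm assms in linarith)
    ultimately show ?thesis by (simp add: tent_def algebra_simps)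
  qed
  show "tent s m \<tau> = s * (s * m + m - \<tau>)" if "s * m \<le> \<tau>" "\<tau> \<le> s * m + m"
  proof -
    have "max 0 (\<tau>) = \<tau>" by (rule max_absorb2) (use that sm assms in linarith)
    moreover have "max 0 (\<tau> - s * m) = \<tau> - s * m" by (rule max_absorb2) (use that sm assms in linarith)
    moreover have "max 0 (\<tau> - (s * m + m)) = 0" by (rule max_absorb1) (use that sm assms in linarith)
    ultimately show ?thesis by (simp add: tent_def algebra_simps)
  qed
  show "tent s m \<tau> = 0" if "s * m + m \<le> \<tau>"
  proof -
    have "max 0 (\<tau>) = \<tau>" by (rule max_absorb2) (use that sm assms in linarith)
    moreover have "max 0 (\<tau> - s * m) = \<tau> - s * m" by (rule max_absorb2) (use that sm assms in linarith)
    moreover have "max 0 (\<tau> - (s * m + m)) = \<tau> - (s * m + m)" by (rule max_absorb2) (use that sm assms in linarith)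
    ultimately show ?thesis by (simp add: tent_def algebra_simps)
  qed
qed

lemma tent_bounds:
  assumes "s > 0" "m > 0"
  shows "0 \<le> tent s m \<tau>" "tent s m \<tau> \<le> s * m"
proof -
  have sm: "s * m > 0" using assms by simp
  consider "\<tau> \<le> 0" | "0 \<le> \<tau>" "\<tau> \<le> s * m" | "s * m \<le> \<tau>" "\<tau> \<le> s * m + m" | "s * m + m \<le> \<tau>"
    by linarith
  then have "0 \<le> tent s m \<tau> \<and> tent s m \<tau> \<le> s * m"
    by cases (use sm assms in \<open>auto simp: tent_values intro!: mult_left_mono\<close>)
  then show "0 \<le> tent s m \<tau>" "tent s m \<tau> \<le> s * m" by auto
qed

text \<open>In the time \<open>\<tau> = \<sigma> * (t - \<theta>)\<close> both sides of \<theta>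
  look alike: an interval without corners whose initial velocity is the one-sided limit
  \<open>u\<close>. \<open>side\<close> guarantees room on the chosen side when \<theta> is an end
  point.\<close>

theorem needle_of_minimum:
  fixes L :: "real \<Rightarrow> 'a::euclidean_space \<Rightarrow> 'a \<Rightarrow> real"
  assumes min: "strong_local_minimum L t0 t1 x0 x1 xb" and t01: "t0 < t1"
    and S: "open S" "{t0..t1} \<subseteq> S"
    and deriv: "\<And>p. p \<in> S \<times> UNIV \<Longrightarrow> ((\<lambda>(t, x, v). L t x v) has_derivative blinfun_apply (f' p)) (at p)"
    and cont: "continuous_on (S \<times> UNIV) f'"
    and \<sigma>: "\<bar>\<sigma>\<bar> = 1" and \<theta>: "\<theta> \<in> {t0..t1}"
    and side: "\<forall>\<^sub>F \<tau> in at_right 0. \<theta> + \<sigma> * \<tau> \<in> {t0<..<t1}"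
    and lim: "((\<lambda>\<tau>. velocity xb (\<theta> + \<sigma> * \<tau>)) \<longlongrightarrow> u) (at_right 0)"
  obtains m0 \<delta> where "needle (\<lambda>(t, x, v). L t x v) f' S
    (\<lambda>\<tau>. (\<theta> + \<sigma> * \<tau>, xb (\<theta> + \<sigma> * \<tau>), ((velocity xb)(\<theta> := u)) (\<theta> + \<sigma> * \<tau>))) \<sigma> m0 \<delta>"
proof -
  let ?f = "\<lambda>(t, x, v). L t x v"
  let ?A = "angular_points t0 t1 xb"
  define X where "X \<tau> = xb (\<theta> + \<sigma> * \<tau>)" for \<tau>
  define V where "V \<tau> = ((velocity xb)(\<theta> := u)) (\<theta> + \<sigma> * \<tau>)" for \<tau>
  define P where "P = (\<lambda>\<tau>. (\<theta> + \<sigma> * \<tau>, X \<tau>, V \<tau>))"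
  have \<sigma>2: "\<sigma> * \<sigma> = 1" and \<sigma>0: "\<sigma> \<noteq> 0" using \<sigma> by (auto simp: abs_if split: if_splits)
  have \<sigma>\<sigma>: "\<sigma> * (\<sigma> * z) = z" for z by (simp add: \<sigma>2 flip: mult.assoc)
  have xb: "xb \<in> KC1 t0 t1" "xb t0 = x0" "xb t1 = x1"
    using min by (auto simp: strong_local_minimum_def admissible_def)
  obtain \<delta> where \<delta>: "\<delta> > 0" "\<And>x. admissible t0 t1 x0 x1 x \<Longrightarrow> C_norm t0 t1 (\<lambda>t. x t - xb t) \<le> \<delta> \<Longrightarrow>
      functional_J L t0 t1 x \<ge> functional_J L t0 t1 xb"
    using min by (auto simp: strong_local_minimum_def)
  have fin: "finite ?A" using xb(1) by (rule KC1_finite)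
  have "finite ((\<lambda>t. \<sigma> * (t - \<theta>)) ` ?A)" using fin by simp
  then have "\<forall>\<^sub>F \<tau> in at_right 0. \<tau> \<notin> (\<lambda>t. \<sigma> * (t - \<theta>)) ` ?A"
    by (rule filter_leD[OF at_le eventually_not_mem_finite, OF subset_UNIV])
  with side have "\<forall>\<^sub>F \<tau> in at_right 0. \<theta> + \<sigma> * \<tau> \<in> {t0<..<t1} - ?A"
  proof eventually_elim
    case (elim \<tau>)
    have "\<tau> = \<sigma> * ((\<theta> + \<sigma> * \<tau>) - \<theta>)" by (simp add: \<sigma>\<sigma>)
    with elim show ?case by blast
  qed
  then obtain b where b: "b > 0" "\<And>\<tau>. 0 < \<tau> \<Longrightarrow> \<tau> < b \<Longrightarrow> \<theta> + \<sigma> * \<tau> \<in> {t0<..<t1} - ?A"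
    unfolding eventually_at_right_field by blast
  \<comment> \<open>Halving keeps the closed end \<open>m0\<close> inside the range free of
    corners.\<close>
  define m0 where "m0 = b / 2"
  have m0: "m0 > 0" using b by (simp add: m0_def)
  have inner: "\<theta> + \<sigma> * \<tau> \<in> {t0<..<t1} - ?A" if "0 < \<tau>" "\<tau> \<le> m0" for \<tau>
    using b that by (simp add: m0_def)
  have inI: "\<theta> + \<sigma> * \<tau> \<in> {t0..t1}" if "0 \<le> \<tau>" "\<tau> \<le> m0" for \<tau>
    using inner[of \<tau>] that \<theta> by (cases "\<tau> = 0") auto
  have V0: "V 0 = u" by (simp add: V_def)
  have Vpos: "V \<tau> = velocity xb (\<theta> + \<sigma> * \<tau>)" if "\<tau> \<noteq> 0" for \<tau> using that \<sigma>0 by (simp add: V_def)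
  have contV: "continuous_on {0..m0} V"
    unfolding continuous_on_eq_continuous_within
  proof
    fix \<tau> assume t: "\<tau> \<in> {0..m0}"
    show "continuous (at \<tau> within {0..m0}) V"
    proof (cases "\<tau> = 0")
      case True
      have "\<forall>\<^sub>F \<tau> in at_right 0. velocity xb (\<theta> + \<sigma> * \<tau>) = V \<tau>"
        using eventually_at_right_less[of 0] by eventually_elim (simp add: Vpos)
      then have "(V \<longlongrightarrow> V 0) (at_right 0)" unfolding V0 by (rule Lim_transform_eventually[OF lim])
      then show ?thesis using True m0 by (simp add: continuous_within at_within_Icc_at_right)
    next
      case False
      then have "isCont (velocity xb) (\<theta> + \<sigma> * \<tau>)" using inner[of \<tau>] t not_angularD(2) by auto
      then have c: "isCont (\<lambda>\<tau>. velocity xb (\<theta> + \<sigma> * \<tau>)) \<tau>"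
        by (rule isCont_o2[rotated]) (intro continuous_intros)
      have "\<forall>\<^sub>F r in nhds \<tau>. V r = velocity xb (\<theta> + \<sigma> * r)"
        using eventually_nhds_in_open[of "{0<..}" \<tau>] False t Vpos by (auto elim!: eventually_mono)
      then have "isCont V \<tau>" using c by (rule isCont_cong[THEN iffD2])
      then show ?thesis by (rule continuous_at_imp_continuous_at_within)
    qed
  qed
  have contX: "continuous_on {0..m0} X"
    unfolding X_def
    by (rule continuous_on_compose2[OF KC1_continuous[OF xb(1)]]) (use inI in \<open>auto intro!: continuous_intros\<close>)
  have contP: "continuous_on {0..m0} P" unfolding P_def by (intro continuous_intros contX contV)
  have contf: "continuous_on (S \<times> UNIV) ?f"
    using deriv has_derivative_continuous by (intro continuous_at_imp_continuous_on ballI) blast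
  then have contfI: "continuous_on ({t0..t1} \<times> UNIV) ?f"
    by (rule continuous_on_subset) (use S(2) in auto)
  have P_in: "P \<tau> \<in> S \<times> UNIV" if "\<tau> \<in> {0..m0}" for \<tau> using inI[of \<tau>] that S(2) by (auto simp: P_def)
  have along: "continuous_on T (\<lambda>\<tau>. ?f (P \<tau> + (0, x \<tau>, v \<tau>)))"
    if "T \<subseteq> {0..m0}" "continuous_on T x" "continuous_on T v" for T x v
  proof (rule continuous_on_compose2[OF contf])
    show "continuous_on T (\<lambda>\<tau>. P \<tau> + (0, x \<tau>, v \<tau>))"
      using that contP continuous_on_subset by (intro continuous_intros) auto
    show "(\<lambda>\<tau>. P \<tau> + (0, x \<tau>, v \<tau>)) ` T \<subseteq> S \<times> UNIV"
      using P_in that(1) by (auto simp: P_def)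
  qed
  have along0: "continuous_on T (\<lambda>\<tau>. ?f (P \<tau>))" if "T \<subseteq> {0..m0}" for T
    using along[OF that continuous_on_const[of _ 0] continuous_on_const[of _ 0]] by (simp flip: zero_prod_def)
  have variation: "0 \<le> integral {0..s*m} (\<lambda>\<tau>. ?f (P \<tau> + (0, (\<sigma> * \<tau>) *\<^sub>R \<eta>, \<eta>)) - ?f (P \<tau>)) +
          integral {s*m..s*m+m} (\<lambda>\<tau>. ?f (P \<tau> + (0, (\<sigma> * s * (s*m+m-\<tau>)) *\<^sub>R \<eta>, (- s) *\<^sub>R \<eta>)) - ?f (P \<tau>))"
    if s: "s > 0" and m: "m > 0" and small: "s * m + m \<le> m0" "s * m * norm \<eta> \<le> \<delta>" for \<eta> s m
  proof -
    define w where "w = s * m + m"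
    have sm: "0 < s * m" "s * m < w" "w \<le> m0" "w > 0" using s m small by (auto simp: w_def add_pos_pos)
    \<comment> \<open>The velocity of a ramp is \<sigma> times its vector. The factor \<sigma> put
      into each vector cancels this one, so the ramps add \<open>\<eta>\<close>,
      \<open>(- (1 + s)) *\<^sub>R \<eta>\<close> and \<open>s *\<^sub>R \<eta>\<close> to the
      velocity.\<close>
    define h where "h t = ramp \<sigma> \<theta> (\<sigma> *\<^sub>R \<eta>) t + ramp \<sigma> (\<theta> + \<sigma> * (s * m)) (- ((1 + s) * \<sigma>) *\<^sub>R \<eta>) t
        + ramp \<sigma> (\<theta> + \<sigma> * w) ((s * \<sigma>) *\<^sub>R \<eta>) t" for t
    define y where "y t = xb t + h t" for t
    have h_tent: "h t = (\<sigma> * tent s m (\<sigma> * (t - \<theta>))) *\<^sub>R \<eta>" for t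
    proof -
      have "\<sigma> * (t - (\<theta> + \<sigma> * c)) = \<sigma> * (t - \<theta>) - c" for c using \<sigma>\<sigma>[of c] by (simp add: algebra_simps)
      moreover have "a *\<^sub>R \<sigma> *\<^sub>R \<eta> + b *\<^sub>R (- ((1 + s) * \<sigma>)) *\<^sub>R \<eta> + c *\<^sub>R (s * \<sigma>) *\<^sub>R \<eta>
          = (\<sigma> * (a - (1 + s) * b + s * c)) *\<^sub>R \<eta>" for a b c
        by (simp add: algebra_simps)
      ultimately show ?thesis
        unfolding h_def ramp_def tent_def w_def[symmetric] by (simp only:)
    qed
    note ramps = ramp_KC1(1)[OF \<sigma>0 t01]
    have hK: "h \<in> KC1 t0 t1" unfolding h_def
      by (intro KC1_add(1) ramps t01)
    then have yK: "y \<in> KC1 t0 t1" unfolding y_def using xb(1) t01 by (intro KC1_add(1)) auto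
    \<comment> \<open>The open support of the tent lies in the interior of the interval by the
      choice of \<open>m0\<close>, even if \<theta> is an end point; therefore the boundary values
      are kept.\<close>
    have out: "\<sigma> * (t - \<theta>) \<le> 0 \<or> w \<le> \<sigma> * (t - \<theta>)" if "t = t0 \<or> t = t1" for t
    proof (rule ccontr)
      assume "\<not> ?thesis"
      then have "\<theta> + \<sigma> * (\<sigma> * (t - \<theta>)) \<in> {t0<..<t1}" using inner[of "\<sigma> * (t - \<theta>)"] sm by auto
      then show False using that by (auto simp: \<sigma>\<sigma>)
    qed
    have hend: "h t0 = 0" "h t1 = 0"
      using out[of t0] out[of t1] tent_values[OF s m] by (auto simp: h_tent w_def)
    have adm: "admissible t0 t1 x0 x1 y"
      using yK xb hend by (simp add: admissible_def y_def)
    have "norm (y t - xb t) \<le> \<delta>" for t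
    proof -
      have "norm (y t - xb t) = tent s m (\<sigma> * (t - \<theta>)) * norm \<eta>"
        using tent_bounds(1)[OF s m] \<sigma> by (simp add: y_def h_tent abs_mult)
      also have "\<dots> \<le> s * m * norm \<eta>" by (intro mult_right_mono tent_bounds s m) auto
      finally show ?thesis using small by simp
    qed
    then have "C_norm t0 t1 (\<lambda>t. y t - xb t) \<le> \<delta>"
      unfolding C_norm_def using t01 by (intro cSUP_least) auto
    then have J: "functional_J L t0 t1 xb \<le> functional_J L t0 t1 y" using \<delta>(2) adm by blast
    define D where "D t = L t (y t) (velocity y t) - L t (xb t) (velocity xb t)" for t
    have int: "(\<lambda>t. L t (y t) (velocity y t)) integrable_on {t0..t1}"
        "(\<lambda>t. L t (xb t) (velocity xb t)) integrable_on {t0..t1}"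
      using KC1_integrable[OF yK t01 contfI] KC1_integrable[OF xb(1) t01 contfI] by auto
    have Dpos: "integral {t0..t1} D \<ge> 0"
      using J unfolding D_def functional_J_def Henstock_Kurzweil_Integration.integral_diff[OF int] by simp
    define G1 where "G1 \<tau> = ?f (P \<tau> + (0, (\<sigma> * \<tau>) *\<^sub>R \<eta>, \<eta>)) - ?f (P \<tau>)" for \<tau>
    define G2 where "G2 \<tau> = ?f (P \<tau> + (0, (\<sigma> * s * (s*m+m-\<tau>)) *\<^sub>R \<eta>, (- s) *\<^sub>R \<eta>)) - ?f (P \<tau>)" for \<tau>
    have "G1 integrable_on {0..s*m}" "G2 integrable_on {s*m..w}"
      unfolding G1_def G2_def
      by (intro integrable_continuous_real continuous_on_diff along along0 continuous_intros; use sm in auto)+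
    then have G: "(G1 has_integral integral {0..s*m} G1) {0..s*m}" "(G2 has_integral integral {s*m..w} G2) {s*m..w}"
      by (auto intro: integrable_integral)
    define T where "T l r = (\<lambda>\<tau>. \<theta> + \<sigma> * \<tau>) ` {l..r}" for l r
    have T_iff: "t \<in> T l r \<longleftrightarrow> \<sigma> * (t - \<theta>) \<in> {l..r}" for t l r
    proof
      assume "\<sigma> * (t - \<theta>) \<in> {l..r}"
      then have "\<theta> + \<sigma> * (\<sigma> * (t - \<theta>)) \<in> T l r" unfolding T_def by (rule imageI)
      then show "t \<in> T l r" by (simp add: \<sigma>\<sigma>)
    qed (auto simp: T_def \<sigma>\<sigma>)
    \<comment> \<open>A change of variables without a factor, as \<sigma> has modulus 1. Extension
      by 0 allows rise and return to be added on the whole interval.\<close>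
    have transfer: "((\<lambda>t. if t \<in> T l r then G (\<sigma> * (t - \<theta>)) else 0) has_integral i) {t0..t1}"
      if "(G has_integral i) {l..r}" "0 \<le> l" "r \<le> m0" for G :: "real \<Rightarrow> real" and i l r
    proof -
      have "((\<lambda>t. G (\<sigma> *\<^sub>R t + (- \<sigma> * \<theta>))) has_integral (1 / (\<bar>\<sigma>\<bar> ^ DIM(real))) *\<^sub>R i)
          ((\<lambda>\<tau>. (1 / \<sigma>) *\<^sub>R \<tau> + - ((1 / \<sigma>) *\<^sub>R (- \<sigma> * \<theta>))) ` cbox l r)"
        by (rule has_integral_affinity) (use that \<sigma>0 in auto)
      moreover have "1 / \<sigma> = \<sigma>" using \<sigma>2 \<sigma>0 by (simp add: field_simps)
      moreover have "(\<lambda>\<tau>. \<sigma> *\<^sub>R \<tau> + - (\<sigma> *\<^sub>R (- \<sigma> * \<theta>))) ` cbox l r = T l r"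
        unfolding T_def by (intro image_cong) (auto simp: \<sigma>\<sigma>)
      ultimately have "((\<lambda>t. G (\<sigma> * (t - \<theta>))) has_integral i) (T l r)"
        using \<sigma> by (simp add: algebra_simps)
      moreover have "T l r \<subseteq> {t0..t1}"
        unfolding T_def using inI that by fastforce
      ultimately show ?thesis by simp
    qed
    have "((\<lambda>t. (if t \<in> T 0 (s*m) then G1 (\<sigma> * (t - \<theta>)) else 0) + (if t \<in> T (s*m) w then G2 (\<sigma> * (t - \<theta>)) else 0))
        has_integral integral {0..s*m} G1 + integral {s*m..w} G2) {t0..t1}"
      by (intro has_integral_add transfer G) (use sm in auto)
    then have "(D has_integral integral {0..s*m} G1 + integral {s*m..w} G2) {t0..t1}"
    proof (rule has_integral_spike_finite[rotated 2])
      \<comment> \<open>Excluded are the corners of the curve and of the tent, the end points, and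
        \<theta>, where the velocity was redefined. This also removes the common point of the two
        pieces, which the sum would count twice.\<close>
      show "finite ({t0, t1, \<theta>, \<theta> + \<sigma> * (s * m), \<theta> + \<sigma> * w} \<union> ?A)" using fin by simp
      fix t assume t: "t \<in> {t0..t1} - ({t0, t1, \<theta>, \<theta> + \<sigma> * (s * m), \<theta> + \<sigma> * w} \<union> ?A)"
      define \<tau> where "\<tau> = \<sigma> * (t - \<theta>)"
      have t_eq: "t = \<theta> + \<sigma> * \<tau>" by (simp add: \<tau>_def \<sigma>\<sigma>)
      have ne: "\<tau> \<noteq> 0" "\<tau> \<noteq> s * m" "\<tau> \<noteq> w" using t t_eq by auto
      have shift: "\<sigma> * (t - (\<theta> + \<sigma> * c)) = \<tau> - c" for c using \<sigma>\<sigma>[of c] by (simp add: \<tau>_def algebra_simps)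
      have Pt: "P \<tau> = (t, xb t, velocity xb t)" using Vpos ne t_eq by (simp add: P_def X_def)
      have "(xb has_vector_derivative velocity xb t) (at t)"
        using t not_angularD(1)[of t t0 t1 xb] by (auto simp: velocity_def vector_derivative_works)
      moreover have "(h has_vector_derivative (if \<tau> > 0 then \<sigma> *\<^sub>R (\<sigma> *\<^sub>R \<eta>) else 0)
         + (if \<tau> - s * m > 0 then \<sigma> *\<^sub>R (- ((1 + s) * \<sigma>) *\<^sub>R \<eta>) else 0)
         + (if \<tau> - w > 0 then \<sigma> *\<^sub>R ((s * \<sigma>) *\<^sub>R \<eta>) else 0)) (at t)"
        unfolding h_def
        using ramp_has_vector_derivative[of \<sigma> t \<theta> "\<sigma> *\<^sub>R \<eta>", folded \<tau>_def]
          ramp_has_vector_derivative[of \<sigma> t "\<theta> + \<sigma> * (s * m)" "- ((1 + s) * \<sigma>) *\<^sub>R \<eta>", unfolded shift]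
          ramp_has_vector_derivative[of \<sigma> t "\<theta> + \<sigma> * w" "(s * \<sigma>) *\<^sub>R \<eta>", unfolded shift] ne
        by (intro has_vector_derivative_add) auto
      ultimately have "(y has_vector_derivative velocity xb t + ((if \<tau> > 0 then \<sigma> *\<^sub>R (\<sigma> *\<^sub>R \<eta>) else 0)
         + (if \<tau> - s * m > 0 then \<sigma> *\<^sub>R (- ((1 + s) * \<sigma>) *\<^sub>R \<eta>) else 0)
         + (if \<tau> - w > 0 then \<sigma> *\<^sub>R ((s * \<sigma>) *\<^sub>R \<eta>) else 0))) (at t)"
        unfolding y_def by (rule has_vector_derivative_add)
      moreover have slopes': "\<sigma> * - ((1 + s) * \<sigma>) = - (1 + s)" "\<sigma> * (s * \<sigma>) = s"
        using \<sigma>2 by algebra+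
      moreover have slopes: "\<sigma> *\<^sub>R (\<sigma> *\<^sub>R \<eta>) = \<eta>" "\<sigma> *\<^sub>R (- ((1 + s) * \<sigma>) *\<^sub>R \<eta>) = (- (1 + s)) *\<^sub>R \<eta>"
        "\<sigma> *\<^sub>R ((s * \<sigma>) *\<^sub>R \<eta>) = s *\<^sub>R \<eta>"
        by (simp_all only: scaleR_scaleR slopes' \<sigma>2 scaleR_one)
      ultimately have vy: "velocity y t = velocity xb t + ((if \<tau> > 0 then \<eta> else 0)
         + (if \<tau> - s * m > 0 then (- (1 + s)) *\<^sub>R \<eta> else 0) + (if \<tau> - w > 0 then s *\<^sub>R \<eta> else 0))"
        unfolding slopes by (simp add: velocity_def[of y] vector_derivative_at)
      have yt: "y t = xb t + (\<sigma> * tent s m \<tau>) *\<^sub>R \<eta>" by (simp add: y_def h_tent \<tau>_def)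
      consider "\<tau> < 0" | "0 < \<tau>" "\<tau> < s * m" | "s * m < \<tau>" "\<tau> < w" | "w < \<tau>" using ne by linarith
      then show "D t = (if t \<in> T 0 (s*m) then G1 (\<sigma> * (t - \<theta>)) else 0) + (if t \<in> T (s*m) w then G2 (\<sigma> * (t - \<theta>)) else 0)"
      proof cases
        case 1
        then show ?thesis using sm yt vy tent_values(1)[OF s m, of \<tau>]
          by (simp add: D_def T_iff flip: \<tau>_def)
      next
        case 2
        then show ?thesis using sm yt vy tent_values(2)[OF s m, of \<tau>] Pt
          by (simp add: D_def T_iff G1_def flip: \<tau>_def)
      next
        case 3
        have "velocity y t = velocity xb t + (- s) *\<^sub>R \<eta>" using vy 3 sm by (simp add: algebra_simps)
        then show ?thesis using sm yt 3 tent_values(3)[OF s m, of \<tau>] Pt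
          by (simp add: D_def T_iff G2_def w_def mult.assoc flip: \<tau>_def)
      next
        case 4
        have "velocity y t = velocity xb t" using vy 4 sm by (simp add: algebra_simps)
        then show ?thesis using sm yt 4 tent_values(4)[OF s m, of \<tau>]
          by (simp add: D_def T_iff w_def flip: \<tau>_def)
      qed
    qed
    then have "integral {t0..t1} D = integral {0..s*m} G1 + integral {s*m..w} G2" by (rule integral_unique)
    with Dpos have "0 \<le> integral {0..s*m} G1 + integral {s*m..w} G2" by simp
    then show ?thesis unfolding G1_def G2_def w_def .
  qed
  have "needle ?f f' S P \<sigma> m0 \<delta>"
    by unfold_locales (use S deriv cont m0 \<delta> \<sigma> contP P_in variation in auto)
  then show thesis by (intro that[of m0 \<delta>]) (simp add: P_def X_def V_def)
qed

subsection \<open>Necessary conditions along the minimizer\<close>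

text \<open>\<open>gradient\<close> is a definite description, so it has a known value only once
  existence and uniqueness are shown; the representing vector is assembled from the values of
  \<open>D\<close> on the basis.\<close>

lemma gradient_inner:
  fixes f :: "'a::euclidean_space \<Rightarrow> real"
  assumes "(f has_derivative D) (at p)"
  shows "gradient f p \<bullet> h = D h"
proof -
  interpret D: bounded_linear D using assms by (rule has_derivative_bounded_linear)
  let ?g = "\<Sum>b\<in>Basis. D b *\<^sub>R b"
  have eq: "h \<bullet> ?g = D h" for h
  proof -
    have "D h = D (\<Sum>b\<in>Basis. (h \<bullet> b) *\<^sub>R b)" by (simp add: euclidean_representation)
    also have "\<dots> = h \<bullet> ?g" by (simp add: D.sum D.scaleR inner_sum_right mult.commute)
    finally show ?thesis by simp
  qed
  have "gradient f p = ?g"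
    unfolding gradient_def
  proof (rule the_equality)
    show "GDERIV f p :> ?g" unfolding gderiv_def eq using assms by simp
    fix g assume "GDERIV f p :> g"
    then have "(\<lambda>h. h \<bullet> g) = D" unfolding gderiv_def using assms by (rule has_derivative_unique)
    then have "h \<bullet> g = h \<bullet> ?g" for h unfolding eq by (rule fun_cong)
    then show "g = ?g" using vector_eq_ldot by blast
  qed
  then show ?thesis using eq[of h] by (simp add: inner_commute)
qed

lemma jacobian_mult:
  fixes F :: "real^'n \<Rightarrow> real^'m"
  assumes "(F has_derivative F') (at v)"
  shows "jacobian F (at v) *v h = F' h"
proof -
  have "(F has_derivative (*v) (jacobian F (at v))) (at v)"
    using assms jacobian_works differentiable_def by blast
  from has_derivative_unique[OF this assms] show ?thesis by (rule fun_cong)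
qed

text \<open>Reads the Jacobian of a gradient as a bilinear form. Differentiability of
  \<open>G\<close> is recovered from its components, so derivatives of scalar expressions suffice as
  input.\<close>

lemma jacobian_inner:
  fixes G :: "real^'n \<Rightarrow> real^'m"
  assumes G: "\<And>w h. G w \<bullet> h = \<phi> w h"
    and \<phi>: "\<And>h. ((\<lambda>w. \<phi> w h) has_derivative \<phi>' h) (at v)"
  shows "h \<bullet> (jacobian G (at v) *v k) = \<phi>' h k"
proof -
  have "((\<lambda>w. \<Sum>b\<in>Basis. \<phi> w b *\<^sub>R b) has_derivative (\<lambda>k. \<Sum>b\<in>Basis. \<phi>' b k *\<^sub>R b)) (at v)"
    by (intro has_derivative_sum has_derivative_scaleR_left \<phi>)
  then have D: "(G has_derivative (\<lambda>k. \<Sum>b\<in>Basis. \<phi>' b k *\<^sub>R b)) (at v)"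
    by (simp add: G[symmetric] euclidean_representation)
  then have "((\<lambda>w. G w \<bullet> h) has_derivative (\<lambda>k. (\<Sum>b\<in>Basis. \<phi>' b k *\<^sub>R b) \<bullet> h)) (at v)"
    by (rule has_derivative_inner_left)
  then have "(\<lambda>k. (\<Sum>b\<in>Basis. \<phi>' b k *\<^sub>R b) \<bullet> h) = \<phi>' h"
    unfolding G using \<phi> by (rule has_derivative_unique)
  from fun_cong[OF this, of k] show ?thesis using jacobian_mult[OF D, of k] by (simp add: inner_commute)
qed

lemma L_x_inner:
  assumes "((\<lambda>(t, x, v). L t x v) has_derivative D) (at (t, x, v))"
  shows "L_x L t x v \<bullet> h = D (0, h, 0)"
proof -
  have "((\<lambda>y. (t, y, v)) has_derivative (\<lambda>h. (0, h, 0))) (at x)"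
    by (auto intro!: derivative_eq_intros)
  from has_derivative_compose[OF this assms]
  have "((\<lambda>y. L t y v) has_derivative (\<lambda>h. D (0, h, 0))) (at x)" by simp
  then show ?thesis unfolding L_x_def by (rule gradient_inner)
qed

lemma L_v_inner:
  assumes "((\<lambda>(t, x, v). L t x v) has_derivative D) (at (t, x, v))"
  shows "L_v L t x v \<bullet> h = D (0, 0, h)"
proof -
  have "((\<lambda>w. (t, x, w)) has_derivative (\<lambda>h. (0, 0, h))) (at v)"
    by (auto intro!: derivative_eq_intros)
  from has_derivative_compose[OF this assms]
  have "((\<lambda>w. L t x w) has_derivative (\<lambda>h. D (0, 0, h))) (at v)" by simp
  then show ?thesis unfolding L_v_def by (rule gradient_inner)
qed

text \<open>Formulated at fixed time and position, because (i) assumes higher smoothness in the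
  velocity alone. The three cases of (i) then differ only in the choice of \<open>u\<close>.\<close>

lemma third_order_condition:
  fixes L :: "real \<Rightarrow> real^'n \<Rightarrow> real^'n \<Rightarrow> real"
  assumes C3: "C3_on UNIV (\<lambda>v. L t x v)"
    and E: "\<And>\<xi>. weierstrass_E L \<xi> t x u \<ge> 0"
    and Q0: "quad_vv L \<eta> t x u = 0"
  shows "gradient (\<lambda>v. quad_vv L \<eta> t x v) u \<bullet> \<eta> = 0"
proof -
  obtain g1 g2 g3 where g1: "\<And>w. ((\<lambda>v. L t x v) has_derivative blinfun_apply (g1 w)) (at w)"
    and g2: "\<And>w. (g1 has_derivative blinfun_apply (g2 w)) (at w)"
    and g3: "\<And>w. (g2 has_derivative blinfun_apply (g3 w)) (at w)"
    using C3 unfolding C3_on_def C2_on_def C1_on_def by auto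
  have Lv: "L_v L t x w \<bullet> h = g1 w h" for w h
    unfolding L_v_def by (rule gradient_inner[OF g1])
  have g1': "((\<lambda>w. g1 w h) has_derivative (\<lambda>k. g2 w k h)) (at w)" for w h
    using g2 by (auto intro!: derivative_eq_intros)
  have Q: "quad_vv L \<eta> t x w = g2 w \<eta> \<eta>" for w
    unfolding quad_vv_def L_vv_def by (rule jacobian_inner[OF Lv g1'])
  have g2': "((\<lambda>w. g2 w \<eta> \<eta>) has_derivative (\<lambda>k. g3 w k \<eta> \<eta>)) (at w)" for w
    using g3 by (auto intro!: derivative_eq_intros)
  have line: "((\<lambda>r. u + r *\<^sub>R \<eta>) has_vector_derivative \<eta>) (at r)" for r
    unfolding has_vector_derivative_def by (auto intro!: derivative_eq_intros)
  have "g3 u \<eta> \<eta> \<eta> = 0"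
  proof (rule third_derivative_zero)
    show "((\<lambda>r. L t x (u + r *\<^sub>R \<eta>) - L t x u - r * g1 u \<eta>) has_real_derivative
        g1 (u + r *\<^sub>R \<eta>) \<eta> - g1 u \<eta>) (at r)" for r
      using has_real_derivative_along[OF line[of r] g1] by (auto intro!: derivative_eq_intros)
    show "((\<lambda>r. g1 (u + r *\<^sub>R \<eta>) \<eta> - g1 u \<eta>) has_real_derivative g2 (u + r *\<^sub>R \<eta>) \<eta> \<eta>) (at r)" for r
      using has_real_derivative_along[OF line[of r] g1'[of \<eta>]] by (auto intro!: derivative_eq_intros)
    show "((\<lambda>r. g2 (u + r *\<^sub>R \<eta>) \<eta> \<eta>) has_real_derivative g3 u \<eta> \<eta> \<eta>) (at 0)"
      using has_real_derivative_along[OF line[of 0] g2'] by simp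
    show "L t x (u + r *\<^sub>R \<eta>) - L t x u - r * g1 u \<eta> \<ge> 0" for r
      using E[of "r *\<^sub>R \<eta>"] by (simp add: weierstrass_E_def Lv)
  qed (use Q0 Q in auto)
  moreover have "gradient (\<lambda>v. quad_vv L \<eta> t x v) u \<bullet> \<eta> = g3 u \<eta> \<eta> \<eta>"
    unfolding Q by (rule gradient_inner[OF g2'])
  ultimately show ?thesis by simp
qed

section \<open>Second order conditions for a smooth Lagrangian\<close>

text \<open>The two derivatives serve different purposes: differentiability of \<open>f'\<close>
  provides the mixed matrix and the expansion of the excess, differentiability of \<open>Lv'\<close>
  that of the quadratic form, which already contains second derivatives of \<open>L\<close>.\<close>

locale smooth_lagrangian =
  fixes L :: "real \<Rightarrow> real^'n \<Rightarrow> real^'n \<Rightarrow> real"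
    and f' :: "real \<times> (real^'n) \<times> (real^'n) \<Rightarrow> (real \<times> (real^'n) \<times> (real^'n)) \<Rightarrow>\<^sub>L real"
    and Lv' :: "real \<times> (real^'n) \<times> (real^'n) \<Rightarrow> (real \<times> (real^'n) \<times> (real^'n)) \<Rightarrow>\<^sub>L (real^'n)"
    and S :: "real set"
  assumes S: "open S"
    and f': "\<And>p. p \<in> S \<times> UNIV \<Longrightarrow> ((\<lambda>(t, x, v). L t x v) has_derivative blinfun_apply (f' p)) (at p)"
    and f'_diff: "\<And>p. p \<in> S \<times> UNIV \<Longrightarrow> f' differentiable (at p)"
    and Lv': "\<And>p. p \<in> S \<times> UNIV \<Longrightarrow> ((\<lambda>(t, x, v). L_v L t x v) has_derivative blinfun_apply (Lv' p)) (at p)"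
    and Lv'_diff: "\<And>p. p \<in> S \<times> UNIV \<Longrightarrow> Lv' differentiable (at p)"
begin

lemma open_SU: "open (S \<times> (UNIV :: ((real^'n) \<times> (real^'n)) set))"
  by (intro open_Times S open_UNIV)

lemma cont_f': "continuous_on (S \<times> UNIV) f'"
  using f'_diff differentiable_imp_continuous_within by (intro continuous_at_imp_continuous_on ballI) blast

lemma f'_v: "(t, x, v) \<in> S \<times> UNIV \<Longrightarrow> f' (t, x, v) (0, 0, h) = L_v L t x v \<bullet> h"
  using L_v_inner[OF f'] by simp

lemma f'_x: "(t, x, v) \<in> S \<times> UNIV \<Longrightarrow> f' (t, x, v) (0, h, 0) = L_x L t x v \<bullet> h"
  using L_x_inner[OF f'] by simp

lemma L_xv_inner:
  assumes "(f' has_derivative D2) (at (t, x, v))" "t \<in> S"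
  shows "h \<bullet> (L_xv L t x v *v k) = D2 (0, 0, k) (0, h, 0)"
  unfolding L_xv_def
proof (rule jacobian_inner)
  show "L_x L t x w \<bullet> h = f' (t, x, w) (0, h, 0)" for w h using f'_x assms(2) by simp
  have "((\<lambda>w. (t, x, w)) has_derivative (\<lambda>h. (0, 0, h))) (at v)"
    by (auto intro!: derivative_eq_intros)
  from has_derivative_compose[OF this assms(1)]
  have "((\<lambda>w. f' (t, x, w)) has_derivative (\<lambda>k. D2 (0, 0, k))) (at v)" .
  then show "((\<lambda>w. f' (t, x, w) (0, h, 0)) has_derivative (\<lambda>k. D2 (0, 0, k) (0, h, 0))) (at v)" for h
    by (auto intro!: derivative_eq_intros)
qed

text \<open>The form is expressed through the derivative of \<open>L_v\<close>, since that
  derivative is known to be differentiable.\<close>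

lemma quad_eq:
  assumes "t \<in> S"
  shows "quad_vv L \<eta> t x v = \<eta> \<bullet> Lv' (t, x, v) (0, 0, \<eta>)"
proof -
  have "((\<lambda>w. (t, x, w)) has_derivative (\<lambda>h. (0, 0, h))) (at v)"
    by (auto intro!: derivative_eq_intros)
  from has_derivative_compose[OF this, OF Lv'] assms
  have "((\<lambda>w. L_v L t x w) has_derivative (\<lambda>h. Lv' (t, x, v) (0, 0, h))) (at v)" by simp
  then show ?thesis unfolding quad_vv_def L_vv_def by (simp add: jacobian_mult)
qed

lemma quad_differentiable:
  assumes "p \<in> S \<times> UNIV"
  shows "(\<lambda>(t, x, v). quad_vv L \<eta> t x v) differentiable (at p)"
proof -
  obtain D where "(Lv' has_derivative D) (at p)" using Lv'_diff[OF assms] by (auto simp: differentiable_def)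
  then have "((\<lambda>p. \<eta> \<bullet> Lv' p (0, 0, \<eta>)) has_derivative (\<lambda>h. \<eta> \<bullet> D h (0, 0, \<eta>))) (at p)"
    by (auto intro!: derivative_eq_intros)
  then have "((\<lambda>(t, x, v). quad_vv L \<eta> t x v) has_derivative (\<lambda>h. \<eta> \<bullet> D h (0, 0, \<eta>))) (at p)"
    by (rule has_derivative_transform_within_open[OF _ open_SU assms]) (auto simp: quad_eq)
  then show ?thesis by (auto simp: differentiable_def)
qed

text \<open>Identifies the quadratic form as the function \<open>Q\<close> that the needle results
  ask for.\<close>

lemma quad_along:
  assumes "p \<in> S \<times> UNIV"
  shows "((\<lambda>r. f' (p + (0, 0, r *\<^sub>R \<eta>)) (0, 0, \<eta>)) has_real_derivative
    (case p of (t, x, v) \<Rightarrow> quad_vv L \<eta> t x v)) (at 0)"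
proof -
  obtain t x v where p: "p = (t, x, v)" by (cases p)
  have t: "t \<in> S" using assms p by simp
  have D: "((\<lambda>p. (case p of (t, x, v) \<Rightarrow> L_v L t x v) \<bullet> \<eta>) has_derivative (\<lambda>h. Lv' p h \<bullet> \<eta>)) (at p)"
    by (rule has_derivative_inner_left[OF Lv'[OF assms]])
  have "((\<lambda>r. p + (0, 0, r *\<^sub>R \<eta>)) has_vector_derivative (0, 0, \<eta>)) (at 0)"
    unfolding has_vector_derivative_def by (auto intro!: derivative_eq_intros)
  from has_real_derivative_along[OF this, of "\<lambda>p. (case p of (t, x, v) \<Rightarrow> L_v L t x v) \<bullet> \<eta>"] D
  show ?thesis using f'_v quad_eq t by (simp add: p inner_commute)
qed

lemma excess_eq:
  assumes "(t, x, v) \<in> S \<times> UNIV"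
  shows "weierstrass_E L \<eta> t x v = (\<lambda>(t, x, v). L t x v) ((t, x, v) + (0, 0, \<eta>)) - L t x v - f' (t, x, v) (0, 0, \<eta>)"
  using f'_v assms by (simp add: weierstrass_E_def)

lemma excess_differentiable:
  assumes "p \<in> S \<times> UNIV"
  shows "(\<lambda>(t, x, v). weierstrass_E L \<eta> t x v) differentiable (at p)"
proof -
  let ?f = "\<lambda>(t, x, v). L t x v"
  obtain D where D: "(f' has_derivative D) (at p)" using f'_diff[OF assms] by (auto simp: differentiable_def)
  have "p + (0, 0, \<eta>) \<in> S \<times> UNIV" using assms by (auto simp: mem_Times_iff)
  then have "(?f has_derivative f' (p + (0, 0, \<eta>))) (at (p + (0, 0, \<eta>)))" by (rule f')
  moreover have "((\<lambda>p. p + (0, 0, \<eta>)) has_derivative (\<lambda>h. h)) (at p)"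
    by (auto intro!: derivative_eq_intros)
  ultimately have "((\<lambda>p. ?f (p + (0, 0, \<eta>))) has_derivative f' (p + (0, 0, \<eta>))) (at p)"
    using has_derivative_compose[of "\<lambda>p. p + (0, 0, \<eta>)" "\<lambda>h. h" p UNIV ?f] by simp
  moreover have "((\<lambda>p. f' p (0, 0, \<eta>)) has_derivative (\<lambda>h. D h (0, 0, \<eta>))) (at p)"
    using D by (auto intro!: derivative_eq_intros)
  ultimately have "((\<lambda>p. ?f (p + (0, 0, \<eta>)) - ?f p - f' p (0, 0, \<eta>)) has_derivative
      (\<lambda>h. f' (p + (0, 0, \<eta>)) h - f' p h - D h (0, 0, \<eta>))) (at p)"
    by (intro has_derivative_diff f' assms)
  then have "((\<lambda>(t, x, v). weierstrass_E L \<eta> t x v) has_derivative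
      (\<lambda>h. f' (p + (0, 0, \<eta>)) h - f' p h - D h (0, 0, \<eta>))) (at p)"
    by (rule has_derivative_transform_within_open[OF _ open_SU assms]) (auto simp: excess_eq)
  then show ?thesis by (auto simp: differentiable_def)
qed

text \<open>Running along \<open>\<tau>\<close> multiplies the tangent \<open>q'\<close> by
  \<sigma>, and linearity of \<open>e'\<close> and \<open>Q'\<close> lets \<sigma> factor out.
  \<open>D\<close> is a half-line for a one-sided derivative and may be the whole line for a
  two-sided one.\<close>

theorem second_order_side:
  assumes ndl: "needle (\<lambda>(t, x, v). L t x v) f' S (\<lambda>\<tau>. (\<theta> + \<sigma> * \<tau>, xb (\<theta> + \<sigma> * \<tau>), vel (\<theta> + \<sigma> * \<tau>))) \<sigma> m0 \<delta>"
    and q: "((\<lambda>t. (t, xb t, vel t)) has_vector_derivative q') (at \<theta> within D)"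
    and D: "(\<lambda>\<tau>. \<theta> + \<sigma> * \<tau>) ` {0<..} \<subseteq> D"
    and e': "((\<lambda>(t, x, v). weierstrass_E L \<eta> t x v) has_derivative e') (at (\<theta>, xb \<theta>, vel \<theta>))"
    and Q': "((\<lambda>(t, x, v). quad_vv L \<eta> t x v) has_derivative Q') (at (\<theta>, xb \<theta>, vel \<theta>))"
    and E0: "weierstrass_E L \<eta> \<theta> (xb \<theta>) (vel \<theta>) = 0"
    and Q0: "quad_vv L \<eta> \<theta> (xb \<theta>) (vel \<theta>) = 0"
  shows "0 \<le> \<sigma> * (\<eta> \<bullet> (L_x L \<theta> (xb \<theta>) (vel \<theta> + \<eta>) - L_x L \<theta> (xb \<theta>) (vel \<theta>)
      - L_xv L \<theta> (xb \<theta>) (vel \<theta>) *v \<eta>) + e' q' + 1/2 * Q' q')"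
proof -
  let ?f = "\<lambda>(t, x, v). L t x v"
  let ?P = "\<lambda>\<tau>. (\<theta> + \<sigma> * \<tau>, xb (\<theta> + \<sigma> * \<tau>), vel (\<theta> + \<sigma> * \<tau>))"
  let ?p = "(\<theta>, xb \<theta>, vel \<theta>)"
  interpret N: needle ?f f' S ?P \<sigma> m0 \<delta> by (rule ndl)
  have p: "?p \<in> S \<times> UNIV" using N.P_in[of 0] N.pos by simp
  interpret e': bounded_linear e' using e' by (rule has_derivative_bounded_linear)
  interpret Q': bounded_linear Q' using Q' by (rule has_derivative_bounded_linear)
  obtain D2 where D2: "(f' has_derivative D2) (at ?p)" using f'_diff[OF p] by (auto simp: differentiable_def)
  have "((\<lambda>\<tau>. \<theta> + \<sigma> * \<tau>) has_vector_derivative \<sigma>) (at_right 0)"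
    unfolding has_vector_derivative_def by (auto intro!: derivative_eq_intros simp: mult.commute)
  moreover have "((\<lambda>t. (t, xb t, vel t)) has_vector_derivative q') (at (\<theta> + \<sigma> * 0) within (\<lambda>\<tau>. \<theta> + \<sigma> * \<tau>) ` {0<..})"
    using has_vector_derivative_within_subset[OF q D] by simp
  ultimately have P': "(?P has_vector_derivative \<sigma> *\<^sub>R q') (at_right 0)"
    using vector_diff_chain_within[of "\<lambda>\<tau>. \<theta> + \<sigma> * \<tau>" \<sigma> 0 "{0<..}" "\<lambda>t. (t, xb t, vel t)" q'] by (simp add: o_def)
  have ex: "((\<lambda>p. ?f (p + (0, 0, \<eta>)) - ?f p - f' p (0, 0, \<eta>)) has_derivative e') (at ?p)"
    by (rule has_derivative_transform_within_open[OF e' open_SU p]) (auto simp: excess_eq)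
  have "0 \<le> \<sigma> * (f' (?P 0 + (0, 0, \<eta>)) (0, \<eta>, 0) - f' (?P 0) (0, \<eta>, 0) - D2 (0, 0, \<eta>) (0, \<eta>, 0))
      + e' (\<sigma> *\<^sub>R q') + Q' (\<sigma> *\<^sub>R q') / 2"
  proof (rule N.second_order[OF P'])
    show "((\<lambda>\<tau>. ?f (?P \<tau> + (0, 0, \<eta>)) - ?f (?P \<tau>) - f' (?P \<tau>) (0, 0, \<eta>)) has_real_derivative e' (\<sigma> *\<^sub>R q')) (at_right 0)"
      using has_real_derivative_along[OF P', of "\<lambda>p. ?f (p + (0, 0, \<eta>)) - ?f p - f' p (0, 0, \<eta>)" e'] ex by simp
    show "?f (?P 0 + (0, 0, \<eta>)) - ?f (?P 0) - f' (?P 0) (0, 0, \<eta>) = 0"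
      using E0 excess_eq[of \<theta> "xb \<theta>" "vel \<theta>" \<eta>] p by simp
    show "((\<lambda>p. f' p (0, \<eta>, 0)) has_derivative (\<lambda>k. D2 k (0, \<eta>, 0))) (at (?P 0))"
      using D2 by (auto intro!: derivative_eq_intros)
    show "((\<lambda>(t, x, v). quad_vv L \<eta> t x v) has_derivative Q') (at (?P 0))" using Q' by simp
    show "(\<lambda>(t, x, v). quad_vv L \<eta> t x v) (?P 0) = 0" using Q0 by simp
  qed (rule quad_along)
  also have "f' (?P 0 + (0, 0, \<eta>)) (0, \<eta>, 0) = \<eta> \<bullet> L_x L \<theta> (xb \<theta>) (vel \<theta> + \<eta>)"
    using f'_x[of \<theta> "xb \<theta>" "vel \<theta> + \<eta>"] p by (simp add: inner_commute)
  also have "f' (?P 0) (0, \<eta>, 0) = \<eta> \<bullet> L_x L \<theta> (xb \<theta>) (vel \<theta>)"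
    using f'_x[of \<theta> "xb \<theta>" "vel \<theta>"] p by (simp add: inner_commute)
  also have "D2 (0, 0, \<eta>) (0, \<eta>, 0) = \<eta> \<bullet> (L_xv L \<theta> (xb \<theta>) (vel \<theta>) *v \<eta>)"
    using L_xv_inner[OF D2] p by simp
  finally show ?thesis by (simp add: e'.scaleR Q'.scaleR inner_diff_right algebra_simps)
qed

end

text \<open>Derivatives within \<open>T\<close> are ordinary ones except at \<theta>. There the
  derivative within \<open>T\<close>, being differentiable and hence continuous, equals the limit of
  the velocity, so the velocity redefined by that limit inherits its differentiability.\<close>

lemma one_sided_velocity:
  fixes xb :: "real \<Rightarrow> 'a::real_normed_vector"
  assumes c: "curve_twice_differentiable_on T xb" and T: "\<theta> \<in> T" "open (T - {\<theta>})"
    and D: "at \<theta> within T = at \<theta> within D" "at \<theta> within D \<noteq> bot"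
  shows "\<exists>q'. ((\<lambda>t. (t, xb t, ((velocity xb)(\<theta> := Lim (at \<theta> within D) (velocity xb))) t)) has_vector_derivative q')
      (at \<theta> within D)"
proof -
  define w where "w t = vector_derivative xb (at t within T)" for t
  have xb': "(xb has_vector_derivative w t) (at t within T)" if "t \<in> T" for t
    using c that unfolding curve_twice_differentiable_on_def differentiable_on_def w_def
    by (simp add: vector_derivative_works)
  have "w differentiable (at \<theta> within T)"
    using c T(1) unfolding curve_twice_differentiable_on_def differentiable_on_def w_def by blast
  then obtain w' where w': "(w has_vector_derivative w') (at \<theta> within T)"
    using vector_derivative_works by blast
  have vel: "velocity xb t = w t" if "t \<in> T - {\<theta>}" for t
  proof -
    have "at t within T = at t" by (rule at_within_open_subset[OF that T(2)]) auto
    then show ?thesis by (simp only: velocity_def w_def)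
  qed
  have "(w \<longlongrightarrow> w \<theta>) (at \<theta> within T)"
    using has_vector_derivative_continuous[OF w'] by (simp add: continuous_within)
  moreover have "\<forall>\<^sub>F t in at \<theta> within T. w t = velocity xb t"
    unfolding eventually_at_filter using vel by auto
  ultimately have lim: "(velocity xb \<longlongrightarrow> w \<theta>) (at \<theta> within D)"
    unfolding D(1)[symmetric] by (rule Lim_transform_eventually)
  then have Lim: "Lim (at \<theta> within D) (velocity xb) = w \<theta>" using D(2) by (intro tendsto_Lim)
  have "(((velocity xb)(\<theta> := w \<theta>)) has_vector_derivative w') (at \<theta> within T)"
    by (rule has_vector_derivative_transform[OF T(1) _ w']) (use vel in auto)
  then have "((\<lambda>t. (t, xb t, ((velocity xb)(\<theta> := w \<theta>)) t)) has_vector_derivative (1, w \<theta>, w')) (at \<theta> within T)"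
    by (intro has_vector_derivative_Pair has_vector_derivative_id xb' T(1))
  then show ?thesis unfolding Lim D(1) by blast
qed

text \<open>The product \<open>1 * \<tau>\<close> is left unreduced so that both sides are literal
  instances of one statement in \<sigma>.\<close>

lemma needle_right:
  fixes L :: "real \<Rightarrow> 'a::euclidean_space \<Rightarrow> 'a \<Rightarrow> real"
  assumes "strong_local_minimum L t0 t1 x0 x1 xb" "t0 < t1" "open S" "{t0..t1} \<subseteq> S"
    "\<And>p. p \<in> S \<times> UNIV \<Longrightarrow> ((\<lambda>(t, x, v). L t x v) has_derivative blinfun_apply (f' p)) (at p)"
    "continuous_on (S \<times> UNIV) f'"
    and \<theta>: "\<theta> \<in> {t0..<t1}" and lim: "(velocity xb \<longlongrightarrow> u) (at_right \<theta>)"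
  obtains m0 \<delta> where "needle (\<lambda>(t, x, v). L t x v) f' S
    (\<lambda>\<tau>. (\<theta> + 1 * \<tau>, xb (\<theta> + 1 * \<tau>), ((velocity xb)(\<theta> := u)) (\<theta> + 1 * \<tau>))) 1 m0 \<delta>"
proof (rule needle_of_minimum[OF assms(1-6), of 1 \<theta> u])
  have "\<forall>\<^sub>F t in at_right \<theta>. t \<in> {t0<..<t1}"
    using eventually_interior_right[of "{}" \<theta> t0 t1] \<theta> by simp
  then show "\<forall>\<^sub>F \<tau> in at_right 0. \<theta> + 1 * \<tau> \<in> {t0<..<t1}"
    by (simp add: eventually_at_right_to_0[of _ \<theta>] add.commute)
  show "((\<lambda>\<tau>. velocity xb (\<theta> + 1 * \<tau>)) \<longlongrightarrow> u) (at_right 0)"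
    using lim by (simp add: filterlim_at_right_to_0[of _ _ \<theta>] add.commute)
qed (use \<theta> in auto)

lemma needle_left:
  fixes L :: "real \<Rightarrow> 'a::euclidean_space \<Rightarrow> 'a \<Rightarrow> real"
  assumes "strong_local_minimum L t0 t1 x0 x1 xb" "t0 < t1" "open S" "{t0..t1} \<subseteq> S"
    "\<And>p. p \<in> S \<times> UNIV \<Longrightarrow> ((\<lambda>(t, x, v). L t x v) has_derivative blinfun_apply (f' p)) (at p)"
    "continuous_on (S \<times> UNIV) f'"
    and \<theta>: "\<theta> \<in> {t0<..t1}" and lim: "(velocity xb \<longlongrightarrow> u) (at_left \<theta>)"
  obtains m0 \<delta> where "needle (\<lambda>(t, x, v). L t x v) f' S
    (\<lambda>\<tau>. (\<theta> + - 1 * \<tau>, xb (\<theta> + - 1 * \<tau>), ((velocity xb)(\<theta> := u)) (\<theta> + - 1 * \<tau>))) (- 1) m0 \<delta>"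
proof (rule needle_of_minimum[OF assms(1-6), of "- 1" \<theta> u])
  have "\<forall>\<^sub>F t in at_left \<theta>. t \<in> {t0<..<t1}"
    using eventually_interior_left[of "{}" \<theta> t0 t1] \<theta> by simp
  then show "\<forall>\<^sub>F \<tau> in at_right 0. \<theta> + - 1 * \<tau> \<in> {t0<..<t1}"
    by (simp add: eventually_at_left_to_right[of _ \<theta>] eventually_at_right_to_0[of _ "- \<theta>"])
  show "((\<lambda>\<tau>. velocity xb (\<theta> + - 1 * \<tau>)) \<longlongrightarrow> u) (at_right 0)"
    using lim by (simp add: filterlim_at_left_to_right[of _ _ \<theta>] filterlim_at_right_to_0[of _ _ "- \<theta>"])
qed (use \<theta> in auto)

lemma needle_weierstrass_E:
  assumes "needle (\<lambda>(t, x, v). L t x v) f' S P \<sigma> m0 \<delta>" "P 0 = (t, x, u)"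
  shows "weierstrass_E L \<xi> t x u \<ge> 0"
proof -
  interpret needle "\<lambda>(t, x, v). L t x v" f' S P \<sigma> m0 \<delta> by (rule assms)
  have "P 0 \<in> S \<times> UNIV" using P_in pos by simp
  then show ?thesis
    using weierstrass[of \<xi>] L_v_inner[OF deriv, of t x u \<xi>] assms(2) by (simp add: weierstrass_E_def)
qed

lemma C2_imp_twice_differentiable:
  assumes "C2_on U f"
  shows "twice_differentiable_on U f"
  using assms unfolding C2_on_def C1_on_def twice_differentiable_on_def differentiable_def by blast

lemma smooth_lagrangianI:
  fixes L :: "real \<Rightarrow> real^'n \<Rightarrow> real^'n \<Rightarrow> real"
  assumes "open S" "twice_differentiable_on (S \<times> UNIV \<times> UNIV) (\<lambda>(t, x, v). L t x v)"
    "twice_differentiable_on (S \<times> UNIV \<times> UNIV) (\<lambda>(t, x, v). L_v L t x v)"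
  shows "\<exists>f' Lv'. smooth_lagrangian L f' Lv' S"
  using assms unfolding twice_differentiable_on_def smooth_lagrangian_def UNIV_Times_UNIV by blast

text \<open>In (iii) this is applied at all points near \<theta>: the form vanishing at \<theta>
  then has a local minimum in time there.\<close>

lemma (in smooth_lagrangian) quad_nonneg:
  assumes "needle (\<lambda>(t, x, v). L t x v) f' S P \<sigma> m0 \<delta>" "P 0 = (t, x, v)"
  shows "quad_vv L \<eta> t x v \<ge> 0"
proof -
  interpret N: needle "\<lambda>(t, x, v). L t x v" f' S P \<sigma> m0 \<delta> by (rule assms)
  have p: "P 0 \<in> S \<times> UNIV" using N.P_in N.pos by simp
  have "isCont (\<lambda>(t, x, v). quad_vv L \<eta> t x v) (P 0)"
    using quad_differentiable[OF p] by (rule differentiable_imp_continuous_within)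
  from N.legendre[OF quad_along this] show ?thesis using assms(2) by simp
qed

section \<open>The necessary conditions (i), (ii) and (iii) at a strong minimum\<close>

text \<open>One-sided derivatives are unique, so the existential quantifier over \<open>DE\<close>
  and \<open>DQ\<close> asserts that the derivatives in (ii) exist and speaks about their values;
  \<open>vel\<close> carries the one-sided limit at \<theta>.\<close>

theorem theorem3p3:
  fixes a b :: ereal and t0 t1 :: real
    and x0 x1 :: "real^'n"
    and L :: "real \<Rightarrow> real^'n \<Rightarrow> real^'n \<Rightarrow> real"
    and xb :: "real \<Rightarrow> real^'n"
  assumes "{t0..t1} \<subseteq> einterval a b" and "t0 < t1"
    and "C1_on (einterval a b \<times> UNIV \<times> UNIV) (\<lambda>(t, x, v). L t x v)"
    and "strong_local_minimum L t0 t1 x0 x1 xb"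
  shows
    "((\<forall>t\<in>einterval a b. \<forall>x. C3_on UNIV (\<lambda>v. L t x v)) \<longrightarrow>
      (\<forall>\<eta>. \<eta> \<noteq> 0 \<longrightarrow>
        (\<forall>\<theta> \<in> {t0<..<t1} - angular_points t0 t1 xb.
           quad_vv L \<eta> \<theta> (xb \<theta>) (velocity xb \<theta>) = 0 \<longrightarrow>
           gradient (\<lambda>v. quad_vv L \<eta> \<theta> (xb \<theta>) v) (velocity xb \<theta>) \<bullet> \<eta> = 0) \<and>
        (\<forall>\<theta> \<in> {t0} \<union> angular_points t0 t1 xb.
           quad_vv L \<eta> \<theta> (xb \<theta>) (velocity_right xb \<theta>) = 0 \<longrightarrow>
           gradient (\<lambda>v. quad_vv L \<eta> \<theta> (xb \<theta>) v) (velocity_right xb \<theta>) \<bullet> \<eta> = 0) \<and>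
        (\<forall>\<theta> \<in> angular_points t0 t1 xb \<union> {t1}.
           quad_vv L \<eta> \<theta> (xb \<theta>) (velocity_left xb \<theta>) = 0 \<longrightarrow>
           gradient (\<lambda>v. quad_vv L \<eta> \<theta> (xb \<theta>) v) (velocity_left xb \<theta>) \<bullet> \<eta> = 0)))
     \<and>
     (twice_differentiable_on (einterval a b \<times> UNIV \<times> UNIV) (\<lambda>(t, x, v). L t x v) \<and>
      twice_differentiable_on (einterval a b \<times> UNIV \<times> UNIV) (\<lambda>(t, x, v). L_v L t x v) \<longrightarrow>
      (\<forall>\<theta> \<alpha> \<eta>. \<eta> \<noteq> 0 \<and> \<alpha> > 0 \<longrightarrow>
        (\<theta> \<in> {t0..<t1} \<and> {\<theta>..<\<theta>+\<alpha>} \<subseteq> {t0..t1} \<and>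
         curve_twice_differentiable_on {\<theta>..<\<theta>+\<alpha>} xb \<and>
         weierstrass_E L \<eta> \<theta> (xb \<theta>) (velocity_right xb \<theta>) = 0 \<and>
         quad_vv L \<eta> \<theta> (xb \<theta>) (velocity_right xb \<theta>) = 0 \<longrightarrow>
         (let u = velocity_right xb \<theta>; vel = (velocity xb)(\<theta> := u) in
          \<exists>DE DQ.
            ((\<lambda>t. weierstrass_E L \<eta> t (xb t) (vel t)) has_real_derivative DE) (at_right \<theta>) \<and>
            ((\<lambda>t. quad_vv L \<eta> t (xb t) (vel t)) has_real_derivative DQ) (at_right \<theta>) \<and>
            \<eta> \<bullet> (L_x L \<theta> (xb \<theta>) (u + \<eta>) - L_x L \<theta> (xb \<theta>) u - L_xv L \<theta> (xb \<theta>) u *v \<eta>)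
              + DE + 1/2 * DQ \<ge> 0)) \<and>
        (\<theta> \<in> {t0<..t1} \<and> {\<theta>-\<alpha><..\<theta>} \<subseteq> {t0..t1} \<and>
         curve_twice_differentiable_on {\<theta>-\<alpha><..\<theta>} xb \<and>
         weierstrass_E L \<eta> \<theta> (xb \<theta>) (velocity_left xb \<theta>) = 0 \<and>
         quad_vv L \<eta> \<theta> (xb \<theta>) (velocity_left xb \<theta>) = 0 \<longrightarrow>
         (let u = velocity_left xb \<theta>; vel = (velocity xb)(\<theta> := u) in
          \<exists>DE DQ.
            ((\<lambda>t. weierstrass_E L \<eta> t (xb t) (vel t)) has_real_derivative DE) (at_left \<theta>) \<and>
            ((\<lambda>t. quad_vv L \<eta> t (xb t) (vel t)) has_real_derivative DQ) (at_left \<theta>) \<and>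
            \<eta> \<bullet> (L_x L \<theta> (xb \<theta>) (u + \<eta>) - L_x L \<theta> (xb \<theta>) u - L_xv L \<theta> (xb \<theta>) u *v \<eta>)
              + DE + 1/2 * DQ \<le> 0))))
     \<and>
     (C2_on (einterval a b \<times> UNIV \<times> UNIV) (\<lambda>(t, x, v). L t x v) \<and>
      C2_on (einterval a b \<times> UNIV \<times> UNIV) (\<lambda>(t, x, v). L_v L t x v) \<longrightarrow>
      (\<forall>\<theta> \<eta>. \<eta> \<noteq> 0 \<and> \<theta> \<in> {t0<..<t1} \<and> curve_twice_differentiable_at \<theta> xb \<and>
         weierstrass_E L \<eta> \<theta> (xb \<theta>) (velocity xb \<theta>) = 0 \<and>
         quad_vv L \<eta> \<theta> (xb \<theta>) (velocity xb \<theta>) = 0 \<longrightarrow>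
         \<eta> \<bullet> (L_x L \<theta> (xb \<theta>) (velocity xb \<theta> + \<eta>) - L_x L \<theta> (xb \<theta>) (velocity xb \<theta>)
              - L_xv L \<theta> (xb \<theta>) (velocity xb \<theta>) *v \<eta>) = 0))"
proof -
  let ?S = "einterval a b"
  note dom = open_einterval[of a b] assms(1)
  have xb: "xb \<in> KC1 t0 t1" using assms(4) by (simp add: strong_local_minimum_def admissible_def)
  obtain f1 where f1: "\<And>p. p \<in> ?S \<times> UNIV \<Longrightarrow> ((\<lambda>(t, x, v). L t x v) has_derivative blinfun_apply (f1 p)) (at p)"
    and f1c: "continuous_on (?S \<times> UNIV) f1"
    using assms(3) unfolding C1_on_def UNIV_Times_UNIV by blast
  have E_right: "weierstrass_E L \<xi> \<theta> (xb \<theta>) u \<ge> 0"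
    if "\<theta> \<in> {t0..<t1}" "(velocity xb \<longlongrightarrow> u) (at_right \<theta>)" for \<theta> u \<xi>
    by (rule needle_right[OF assms(4,2) dom f1 f1c that], assumption) (erule needle_weierstrass_E, simp)
  have E_left: "weierstrass_E L \<xi> \<theta> (xb \<theta>) u \<ge> 0"
    if "\<theta> \<in> {t0<..t1}" "(velocity xb \<longlongrightarrow> u) (at_left \<theta>)" for \<theta> u \<xi>
    by (rule needle_left[OF assms(4,2) dom f1 f1c that], assumption) (erule needle_weierstrass_E, simp)
  have lim: "(velocity xb \<longlongrightarrow> velocity xb \<theta>) (at \<theta> within D)"
    if "\<theta> \<in> {t0<..<t1} - angular_points t0 t1 xb" for \<theta> D
    using not_angularD(2)[OF that] tendsto_mono[OF at_le[of D UNIV \<theta>]] unfolding isCont_def by blast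
  have E_regular: "weierstrass_E L \<xi> \<theta> (xb \<theta>) (velocity xb \<theta>) \<ge> 0"
    if "\<theta> \<in> {t0<..<t1} - angular_points t0 t1 xb" for \<theta> \<xi>
    using E_right[OF _ lim[OF that]] that by auto
  have lim_right: "(velocity xb \<longlongrightarrow> velocity_right xb \<theta>) (at_right \<theta>)" if "\<theta> \<in> {t0..<t1}" for \<theta>
  proof -
    from KC1_right_limit[OF xb that] obtain l where "(velocity xb \<longlongrightarrow> l) (at_right \<theta>)" ..
    then show ?thesis unfolding velocity_right_def by (simp add: tendsto_Lim)
  qed
  have lim_left: "(velocity xb \<longlongrightarrow> velocity_left xb \<theta>) (at_left \<theta>)" if "\<theta> \<in> {t0<..t1}" for \<theta>
  proof -
    from KC1_left_limit[OF xb that] obtain l where "(velocity xb \<longlongrightarrow> l) (at_left \<theta>)" ..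
    then show ?thesis unfolding velocity_left_def by (simp add: tendsto_Lim)
  qed
  have ang: "angular_points t0 t1 xb \<subseteq> {t0<..<t1}" by (auto simp: angular_points_def)
  show ?thesis
  proof (intro conjI impI allI ballI, goal_cases)
    case (1 \<eta> \<theta>)
    then have \<theta>: "\<theta> \<in> {t0<..<t1} - angular_points t0 t1 xb" "\<theta> \<in> ?S" using dom(2) by auto
    show ?case
      by (rule third_order_condition[OF _ E_regular[OF \<theta>(1)]]) (use 1 \<theta> in auto)
  next
    case (2 \<eta> \<theta>)
    then have \<theta>: "\<theta> \<in> {t0..<t1}" using ang assms(2) by auto
    show ?case
      by (rule third_order_condition[OF _ E_right[OF \<theta> lim_right[OF \<theta>]]]) (use 2 \<theta> subsetD[OF dom(2), of \<theta>] in auto)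
  next
    case (3 \<eta> \<theta>)
    then have \<theta>: "\<theta> \<in> {t0<..t1}" using ang assms(2) by auto
    show ?case
      by (rule third_order_condition[OF _ E_left[OF \<theta> lim_left[OF \<theta>]]]) (use 3 \<theta> subsetD[OF dom(2), of \<theta>] in auto)
  next
    case (4 \<theta> \<alpha> \<eta>)
    then obtain f' Lv' where "smooth_lagrangian L f' Lv' ?S" using smooth_lagrangianI[OF dom(1)] by blast
    then interpret smooth_lagrangian L f' Lv' ?S .
    let ?u = "velocity_right xb \<theta>" and ?T = "{\<theta>..<\<theta>+\<alpha>}"
    have \<theta>: "\<theta> \<in> {t0..<t1}" "\<alpha> > 0" and \<theta>T: "\<theta> \<in> ?T"
      and c: "curve_twice_differentiable_on ?T xb" using 4 by auto
    have "?T - {\<theta>} = {\<theta><..<\<theta>+\<alpha>}" using \<theta> by auto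
    then have op: "open (?T - {\<theta>})" by simp
    have at: "at \<theta> within ?T = at_right \<theta>"
      by (rule at_within_nhd[where S="{..<\<theta>+\<alpha>}"]) (use \<theta> in auto)
    obtain q' where q: "((\<lambda>t. (t, xb t, ((velocity xb)(\<theta> := ?u)) t)) has_vector_derivative q') (at_right \<theta>)"
      using one_sided_velocity[OF c \<theta>T op at] unfolding velocity_right_def by auto
    obtain m0 \<delta> where ndl: "needle (\<lambda>(t, x, v). L t x v) f' ?S
        (\<lambda>\<tau>. (\<theta> + 1 * \<tau>, xb (\<theta> + 1 * \<tau>), ((velocity xb)(\<theta> := ?u)) (\<theta> + 1 * \<tau>))) 1 m0 \<delta>"
      by (rule needle_right[OF assms(4,2) dom f' cont_f' \<theta>(1) lim_right[OF \<theta>(1)]])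
    have p: "(\<theta>, xb \<theta>, ?u) \<in> ?S \<times> UNIV" using \<theta> dom by auto
    obtain e' where e': "((\<lambda>(t, x, v). weierstrass_E L \<eta> t x v) has_derivative e') (at (\<theta>, xb \<theta>, ?u))"
      using excess_differentiable[OF p] unfolding differentiable_def by blast
    obtain Q' where Q': "((\<lambda>(t, x, v). quad_vv L \<eta> t x v) has_derivative Q') (at (\<theta>, xb \<theta>, ?u))"
      using quad_differentiable[OF p] unfolding differentiable_def by blast
    have im: "(\<lambda>\<tau>. \<theta> + 1 * \<tau>) ` {0<..} \<subseteq> {\<theta><..}" by auto
    have "0 \<le> 1 * (\<eta> \<bullet> (L_x L \<theta> (xb \<theta>) (?u + \<eta>) - L_x L \<theta> (xb \<theta>) ?u - L_xv L \<theta> (xb \<theta>) ?u *v \<eta>)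
        + e' q' + 1/2 * Q' q')"
      using second_order_side[OF ndl q im, where e'=e' and \<eta>=\<eta> and Q'=Q'] e' Q' 4 by auto
    moreover have "((\<lambda>t. weierstrass_E L \<eta> t (xb t) (((velocity xb)(\<theta> := ?u)) t)) has_real_derivative e' q') (at_right \<theta>)"
      using has_real_derivative_along[OF q, of "\<lambda>(t, x, v). weierstrass_E L \<eta> t x v" e'] e' by simp
    moreover have "((\<lambda>t. quad_vv L \<eta> t (xb t) (((velocity xb)(\<theta> := ?u)) t)) has_real_derivative Q' q') (at_right \<theta>)"
      using has_real_derivative_along[OF q, of "\<lambda>(t, x, v). quad_vv L \<eta> t x v" Q'] Q' by simp
    ultimately show ?case unfolding Let_def by (intro exI conjI) (assumption, assumption, simp)
  next
    case (5 \<theta> \<alpha> \<eta>)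
    then obtain f' Lv' where "smooth_lagrangian L f' Lv' ?S" using smooth_lagrangianI[OF dom(1)] by blast
    then interpret smooth_lagrangian L f' Lv' ?S .
    let ?u = "velocity_left xb \<theta>" and ?T = "{\<theta>-\<alpha><..\<theta>}"
    have \<theta>: "\<theta> \<in> {t0<..t1}" "\<alpha> > 0" and \<theta>T: "\<theta> \<in> ?T"
      and c: "curve_twice_differentiable_on ?T xb" using 5 by auto
    have "?T - {\<theta>} = {\<theta>-\<alpha><..<\<theta>}" using \<theta> by auto
    then have op: "open (?T - {\<theta>})" by simp
    have at: "at \<theta> within ?T = at_left \<theta>"
      by (rule at_within_nhd[where S="{\<theta>-\<alpha><..}"]) (use \<theta> in auto)
    obtain q' where q: "((\<lambda>t. (t, xb t, ((velocity xb)(\<theta> := ?u)) t)) has_vector_derivative q') (at_left \<theta>)"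
      using one_sided_velocity[OF c \<theta>T op at] unfolding velocity_left_def by auto
    obtain m0 \<delta> where ndl: "needle (\<lambda>(t, x, v). L t x v) f' ?S
        (\<lambda>\<tau>. (\<theta> + - 1 * \<tau>, xb (\<theta> + - 1 * \<tau>), ((velocity xb)(\<theta> := ?u)) (\<theta> + - 1 * \<tau>))) (- 1) m0 \<delta>"
      by (rule needle_left[OF assms(4,2) dom f' cont_f' \<theta>(1) lim_left[OF \<theta>(1)]])
    have p: "(\<theta>, xb \<theta>, ?u) \<in> ?S \<times> UNIV" using \<theta> dom by auto
    obtain e' where e': "((\<lambda>(t, x, v). weierstrass_E L \<eta> t x v) has_derivative e') (at (\<theta>, xb \<theta>, ?u))"
      using excess_differentiable[OF p] unfolding differentiable_def by blast
    obtain Q' where Q': "((\<lambda>(t, x, v). quad_vv L \<eta> t x v) has_derivative Q') (at (\<theta>, xb \<theta>, ?u))"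
      using quad_differentiable[OF p] unfolding differentiable_def by blast
    have im: "(\<lambda>\<tau>. \<theta> + - 1 * \<tau>) ` {0<..} \<subseteq> {..<\<theta>}" by auto
    have "0 \<le> - 1 * (\<eta> \<bullet> (L_x L \<theta> (xb \<theta>) (?u + \<eta>) - L_x L \<theta> (xb \<theta>) ?u - L_xv L \<theta> (xb \<theta>) ?u *v \<eta>)
        + e' q' + 1/2 * Q' q')"
      using second_order_side[OF ndl q im, where e'=e' and \<eta>=\<eta> and Q'=Q'] e' Q' 5 by auto
    moreover have "((\<lambda>t. weierstrass_E L \<eta> t (xb t) (((velocity xb)(\<theta> := ?u)) t)) has_real_derivative e' q') (at_left \<theta>)"
      using has_real_derivative_along[OF q, of "\<lambda>(t, x, v). weierstrass_E L \<eta> t x v" e'] e' by simp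
    moreover have "((\<lambda>t. quad_vv L \<eta> t (xb t) (((velocity xb)(\<theta> := ?u)) t)) has_real_derivative Q' q') (at_left \<theta>)"
      using has_real_derivative_along[OF q, of "\<lambda>(t, x, v). quad_vv L \<eta> t x v" Q'] Q' by simp
    ultimately show ?case unfolding Let_def by (intro exI conjI) (assumption, assumption, simp)
  next
    case (6 \<theta> \<eta>)
    then have "\<exists>f' Lv'. smooth_lagrangian L f' Lv' ?S"
      by (intro smooth_lagrangianI dom(1) C2_imp_twice_differentiable) auto
    then obtain f' Lv' where "smooth_lagrangian L f' Lv' ?S" by blast
    then interpret smooth_lagrangian L f' Lv' ?S .
    let ?u = "velocity xb \<theta>" and ?I = "{t0<..<t1} - (angular_points t0 t1 xb - {\<theta>})"
    have \<theta>: "\<theta> \<in> {t0<..<t1}" using 6 by simp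
    have E0: "weierstrass_E L \<eta> \<theta> (xb \<theta>) ?u = 0" and Q0: "quad_vv L \<eta> \<theta> (xb \<theta>) ?u = 0" using 6 by auto
    have "curve_twice_differentiable_at \<theta> xb" using 6 by simp
    then have "xb differentiable (at \<theta>)" and v: "velocity xb differentiable (at \<theta>)"
      unfolding curve_twice_differentiable_at_def by (auto dest: eventually_nhds_x_imp_x)
    then have reg: "\<theta> \<in> {t0<..<t1} - angular_points t0 t1 xb"
      using \<theta> differentiable_imp_continuous_within[of "velocity xb" \<theta> UNIV] by (auto simp: angular_points_def)
    obtain w where w: "(velocity xb has_vector_derivative w) (at \<theta>)" using v vector_derivative_works by blast
    have "(xb has_vector_derivative ?u) (at \<theta>)"
      using \<open>xb differentiable (at \<theta>)\<close> unfolding velocity_def vector_derivative_works .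
    then have q: "((\<lambda>t. (t, xb t, velocity xb t)) has_vector_derivative (1, ?u, w)) (at \<theta>)"
      by (intro has_vector_derivative_Pair has_vector_derivative_id w)
    obtain m0 \<delta> where ndl1: "needle (\<lambda>(t, x, v). L t x v) f' ?S
        (\<lambda>\<tau>. (\<theta> + 1 * \<tau>, xb (\<theta> + 1 * \<tau>), ((velocity xb)(\<theta> := ?u)) (\<theta> + 1 * \<tau>))) 1 m0 \<delta>"
      by (rule needle_right[OF assms(4,2) dom f' cont_f' _ lim[OF reg]]) (use \<theta> in auto)
    obtain m1 \<delta>1 where ndl2: "needle (\<lambda>(t, x, v). L t x v) f' ?S
        (\<lambda>\<tau>. (\<theta> + - 1 * \<tau>, xb (\<theta> + - 1 * \<tau>), ((velocity xb)(\<theta> := ?u)) (\<theta> + - 1 * \<tau>))) (- 1) m1 \<delta>1"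
      by (rule needle_left[OF assms(4,2) dom f' cont_f' _ lim[OF reg]]) (use \<theta> in auto)
    have p: "(\<theta>, xb \<theta>, ?u) \<in> ?S \<times> UNIV" using \<theta> dom by auto
    obtain e' where e': "((\<lambda>(t, x, v). weierstrass_E L \<eta> t x v) has_derivative e') (at (\<theta>, xb \<theta>, ?u))"
      using excess_differentiable[OF p] unfolding differentiable_def by blast
    obtain Q' where Q': "((\<lambda>(t, x, v). quad_vv L \<eta> t x v) has_derivative Q') (at (\<theta>, xb \<theta>, ?u))"
      using quad_differentiable[OF p] unfolding differentiable_def by blast
    \<comment> \<open>At a regular point the velocity is its own limit, so the update at \<theta>
      changes nothing and one two-sided tangent serves both signs of \<sigma>.\<close>
    have side: "0 \<le> \<sigma> * (\<eta> \<bullet> (L_x L \<theta> (xb \<theta>) (?u + \<eta>) - L_x L \<theta> (xb \<theta>) ?u - L_xv L \<theta> (xb \<theta>) ?u *v \<eta>)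
        + e' (1, ?u, w) + 1/2 * Q' (1, ?u, w))"
      if "needle (\<lambda>(t, x, v). L t x v) f' ?S
        (\<lambda>\<tau>. (\<theta> + \<sigma> * \<tau>, xb (\<theta> + \<sigma> * \<tau>), ((velocity xb)(\<theta> := ?u)) (\<theta> + \<sigma> * \<tau>))) \<sigma> m \<delta>" for \<sigma> m \<delta>
      using second_order_side[OF that[unfolded fun_upd_triv] q subset_UNIV e' Q' E0 Q0] .
    have "finite (angular_points t0 t1 xb - {\<theta>})" using KC1_finite[OF xb] by simp
    then have "open ?I" by (intro open_Diff finite_imp_closed) auto
    then obtain d where d: "d > 0" "\<And>t. \<bar>\<theta> - t\<bar> < d \<Longrightarrow> t \<in> ?I"
    proof -
      have "\<theta> \<in> ?I" using \<theta> by simp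
      then obtain d where "d > 0" "\<And>t. \<bar>t - \<theta>\<bar> < d \<Longrightarrow> t \<in> ?I"
        using \<open>open ?I\<close> unfolding open_dist dist_real_def by blast
      then show thesis by (intro that[of d]) (auto simp only: abs_minus_commute)
    qed
    have near: "t \<in> {t0<..<t1} - angular_points t0 t1 xb" if "\<bar>\<theta> - t\<bar> < d" for t
      using d(2)[OF that] reg by auto
    have "((\<lambda>t. weierstrass_E L \<eta> t (xb t) (velocity xb t)) has_real_derivative e' (1, ?u, w)) (at \<theta>)"
      using has_real_derivative_along[OF q, of "\<lambda>(t, x, v). weierstrass_E L \<eta> t x v" e'] e' by simp
    \<comment> \<open>By the Weierstrass inequality at neighbouring regular points, the excess along
      the curve is nonnegative near \<theta>, where it vanishes.\<close>
    then have "e' (1, ?u, w) = 0"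
      by (rule DERIV_local_min[OF _ d(1)]) (use near E_regular E0 in auto)
    moreover have "Q' (1, ?u, w) = 0"
    proof (rule DERIV_local_min[OF _ d(1)])
      show "((\<lambda>t. quad_vv L \<eta> t (xb t) (velocity xb t)) has_real_derivative Q' (1, ?u, w)) (at \<theta>)"
        using has_real_derivative_along[OF q, of "\<lambda>(t, x, v). quad_vv L \<eta> t x v" Q'] Q' by simp
      show "\<forall>t. \<bar>\<theta> - t\<bar> < d \<longrightarrow> quad_vv L \<eta> \<theta> (xb \<theta>) ?u \<le> quad_vv L \<eta> t (xb t) (velocity xb t)"
      proof (intro allI impI)
        fix t assume "\<bar>\<theta> - t\<bar> < d"
        then have t: "t \<in> {t0<..<t1} - angular_points t0 t1 xb" by (rule near)
        obtain m \<delta> where "needle (\<lambda>(t, x, v). L t x v) f' ?S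
            (\<lambda>\<tau>. (t + 1 * \<tau>, xb (t + 1 * \<tau>), ((velocity xb)(t := velocity xb t)) (t + 1 * \<tau>))) 1 m \<delta>"
          by (rule needle_right[OF assms(4,2) dom f' cont_f' _ lim[OF t]]) (use t in auto)
        then have "quad_vv L \<eta> t (xb t) (velocity xb t) \<ge> 0" by (rule quad_nonneg) simp
        then show "quad_vv L \<eta> \<theta> (xb \<theta>) ?u \<le> quad_vv L \<eta> t (xb t) (velocity xb t)" using Q0 by simp
      qed
    qed
    \<comment> \<open>With both derivatives equal to 0, the signs 1 and -1 give opposite
      inequalities for the remaining bracket.\<close>
    ultimately show ?case using side[OF ndl1] side[OF ndl2] by simp
  qed
qed

end
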